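(* Let $T:V\to\mathfrak g$ be a relative Rota-Baxter operator on a Lie-Yamaguti algebra $(\mathfrak g,[\cdot,\cdot],[\![\cdot,\cdot,\cdot]\!])$ (over a field $\mathbb K$ of characteristic $0$) with respect to a representation $(V;\rho,\mu)$. Let $\mathrm d=\delta^T:C^n(V,\mathfrak g)\to C^{n+1}(V,\mathfrak g)$ ($n\ge0$) be the Yamaguti coboundary operator of the sub-adjacent Lie-Yamaguti algebra $(V,[\cdot,\cdot]_T,[\![\cdot,\cdot,\cdot]\!]_T)$ with coefficients in the representation $(\mathfrak g;\varrho,\varpi)$, and let $l_1^T(P)=l_2(T,P)+\frac12l_3(T,T,P)$. Then $$\mathrm d(F)=(-1)^{n-1}\,l_1^T(F)\quad\text{for all }F\in C^n(V,\mathfrak g),\ n=1,2,3,\dots,$$ $$\mathrm d(f)=l_1^T(f)\quad\text{for all }f\in C^0(V,\mathfrak g)=\mathrm{Hom}(V,\mathfrak g).$$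
   Context: Lie-Yamaguti algebra: a vector space $\mathfrak g$ with a bilinear bracket $[\cdot,\cdot]:\wedge^2\mathfrak g\to\mathfrak g$ and a trilinear bracket $[\![\cdot,\cdot,\cdot]\!]:\wedge^2\mathfrak g\otimes\mathfrak g\to\mathfrak g$ such that for all $x,y,z,w,t\in\mathfrak g$: (1) $[[x,y],z]+[[y,z],x]+[[z,x],y]+[\![x,y,z]\!]+[\![y,z,x]\!]+[\![z,x,y]\!]=0$; (2) $[\![[x,y],z,w]\!]+[\![[y,z],x,w]\!]+[\![[z,x],y,w]\!]=0$; (3) $[\![x,y,[z,w]]\!]=[[\![x,y,z]\!],w]+[z,[\![x,y,w]\!]]$; (4) $[\![x,y,[\![z,w,t]\!]]\!]=[\![[\![x,y,z]\!],w,t]\!]+[\![z,[\![x,y,w]\!],t]\!]+[\![z,w,[\![x,y,t]\!]]\!]$. Representation $(V;\rho,\mu)$: a vector space $V$ with linear maps $\rho:\mathfrak g\to\mathfrak{gl}(V)$, $\mu:\otimes^2\mathfrak g\to\mathfrak{gl}(V)$ such that, with $D(x,y)=D_{\rho,\mu}(x,y):=\mu(y,x)-\mu(x,y)+[\rho(x),\rho(y)]-\rho([x,y])$, for all $x,y,z,w\in\mathfrak g$: $\mu([x,y],z)-\mu(x,z)\rho(y)+\mu(y,z)\rho(x)=0$; $\mu(x,[y,z])-\rho(y)\mu(x,z)+\rho(z)\mu(x,y)=0$; $\rho([\![x,y,z]\!])=[D(x,y),\rho(z)]$; $\mu(z,w)\mu(x,y)-\mu(y,w)\mu(x,z)-\mu(x,[\![y,z,w]\!])+D(y,z)\mu(x,w)=0$;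 $\mu([\![x,y,z]\!],w)+\mu(z,[\![x,y,w]\!])=[D(x,y),\mu(z,w)]$. Relative Rota-Baxter operator on $\mathfrak g$ with respect to $(V;\rho,\mu)$: a linear map $T:V\to\mathfrak g$ with, for all $u,v,w\in V$, $[Tu,Tv]=T(\rho(Tu)v-\rho(Tv)u)$ and $[\![Tu,Tv,Tw]\!]=T(D(Tu,Tv)w+\mu(Tv,Tw)u-\mu(Tu,Tw)v)$. Sub-adjacent Lie-Yamaguti algebra of $T$: $V$ with $[u,v]_T=\rho(Tu)v-\rho(Tv)u$, $[\![u,v,w]\!]_T=D(Tu,Tv)w+\mu(Tv,Tw)u-\mu(Tu,Tw)v$. It has the representation $(\mathfrak g;\varrho,\varpi)$ given by $\varrho(u)x=[Tu,x]+T(\rho(x)u)$, $\varpi(u,v)x=[\![x,Tu,Tv]\!]-T(D(x,Tu)v-\mu(x,Tv)u)$, for which $D_{\varrho,\varpi}(u,v)x=[\![Tu,Tv,x]\!]-T(\mu(Tv,x)u-\mu(Tu,x)v)$. Cochains: $C^0(V,\mathfrak g)=\mathrm{Hom}(V,\mathfrak g)$ and, for $p\ge1$, $C^p(V,\mathfrak g)=\mathrm{Hom}((\wedge^2V)^{\otimes p},\mathfrak g)\oplus\mathrm{Hom}((\wedge^2V)^{\otimes p}\otimes V,\mathfrak g)$ (degree $p$); elements are pairs. (In Yamaguti's indexing $C^p(V,\mathfrak g)$ is the space of $(p+1)$-cochains.) Yamaguti coboundary $\delta^T=(\delta^T_{\rm I},\delta^T_{\rm II})$: let $\mathcal V_i=u_i\wedge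 v_i\in\wedge^2V$, $w\in V$, $\mathcal V_k\circ\mathcal V_l=[\![u_k,v_k,u_l]\!]_T\wedge v_l+u_l\wedge[\![u_k,v_k,v_l]\!]_T$, hat denoting omission. For $n\ge1$, $F=(f,g)\in C^n(V,\mathfrak g)$: $$\delta^T_{\rm I}F(\mathcal V_1,\dots,\mathcal V_{n+1})=(-1)^n\big(\varrho(u_{n+1})g(\mathcal V_1,\dots,\mathcal V_n,v_{n+1})-\varrho(v_{n+1})g(\mathcal V_1,\dots,\mathcal V_n,u_{n+1})-g(\mathcal V_1,\dots,\mathcal V_n,[u_{n+1},v_{n+1}]_T)\big)$$ $$+\sum_{k=1}^n(-1)^{k+1}D_{\varrho,\varpi}(\mathcal V_k)f(\mathcal V_1,\dots,\hat{\mathcal V}_k,\dots,\mathcal V_{n+1})+\sum_{1\le k<l\le n+1}(-1)^kf(\mathcal V_1,\dots,\hat{\mathcal V}_k,\dots,\mathcal V_k\circ\mathcal V_l,\dots,\mathcal V_{n+1}),$$ $$\delta^T_{\rm II}F(\mathcal V_1,\dots,\mathcal V_{n+1},w)=(-1)^n\big(\varpi(v_{n+1},w)g(\mathcal V_1,\dots,\mathcal V_n,u_{n+1})-\varpi(u_{n+1},w)g(\mathcal V_1,\dots,\mathcal V_n,v_{n+1})\big)$$ $$+\sum_{k=1}^{n+1}(-1)^{k+1}D_{\varrho,\varpi}(\mathcal V_k)g(\mathcal V_1,\dots,\hat{\mathcal V}_k,\dots,\mathcal V_{n+1},w)+\sum_{1\le k<l\le n+1}(-1)^kg(\mathcal V_1,\dots,\hat{\mathcal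 V}_k,\dots,\mathcal V_k\circ\mathcal V_l,\dots,\mathcal V_{n+1},w)$$ $$+\sum_{k=1}^{n+1}(-1)^kg(\mathcal V_1,\dots,\hat{\mathcal V}_k,\dots,\mathcal V_{n+1},[\![u_k,v_k,w]\!]_T).$$ For $f\in\mathrm{Hom}(V,\mathfrak g)$: $\delta^T_{\rm I}f(u,v)=\varrho(u)f(v)-\varrho(v)f(u)-f([u,v]_T)$, $\delta^T_{\rm II}f(u,v,w)=D_{\varrho,\varpi}(u,v)f(w)+\varpi(v,w)f(u)-\varpi(u,w)f(v)-f([\![u,v,w]\!]_T)$. Shuffles: $\mathbb S_{(i,n-i)}$ is the set of $\sigma\in S_n$ with $\sigma(1)<\cdots<\sigma(i)$ and $\sigma(i+1)<\cdots<\sigma(n)$ (only the identity if $i=0$ or $i=n$). The graded Lie algebra $(\mathfrak C^\bullet(E,E),[\cdot,\cdot]_{\mathsf{LieY}})$ for a vector space $E$ (here $E=\mathfrak g\oplus V$): $\mathfrak C^0(E,E)=\mathrm{Hom}(E,E)$ and, for $p\ge1$, $\mathfrak C^p(E,E)=\mathrm{Hom}((\wedge^2E)^{\otimes p},E)\oplus\mathrm{Hom}((\wedge^2E)^{\otimes p}\otimes E,E)$, in degree $p$; elements are written $P=(P_{\rm I},P_{\rm II})$. Below $\mathfrak X_i=x_i\wedge y_i\in\wedge^2E$ and $x\in E$. For $P\in\mathfrak C^p$, $Q\in\mathfrak C^q$ with $p,q\ge1$, $P\circ Q\in\mathfrak C^{p+q}$ is given by $$(P\circ Q)_{\rm I}(\mathfrak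 X_1,\dots,\mathfrak X_{p+q})=\sum_{\sigma\in\mathbb S_{(p,q)},\,\sigma(p+q)=p+q}(-1)^{pq}\mathrm{sign}(\sigma)P_{\rm II}(\mathfrak X_{\sigma(1)},\dots,\mathfrak X_{\sigma(p)},Q_{\rm I}(\mathfrak X_{\sigma(p+1)},\dots,\mathfrak X_{\sigma(p+q)}))$$ $$+\sum_{k=1}^p(-1)^{(k-1)q}\sum_{\sigma\in\mathbb S_{(k-1,q)}}\mathrm{sign}(\sigma)P_{\rm I}(\mathfrak X_{\sigma(1)},\dots,\mathfrak X_{\sigma(k-1)},x_{k+q}\wedge Q_{\rm II}(\mathfrak X_{\sigma(k)},\dots,\mathfrak X_{\sigma(k+q-1)},y_{k+q}),\mathfrak X_{k+q+1},\dots,\mathfrak X_{p+q})$$ $$+\sum_{k=1}^p(-1)^{(k-1)q}\sum_{\sigma\in\mathbb S_{(k-1,q)}}\mathrm{sign}(\sigma)P_{\rm I}(\mathfrak X_{\sigma(1)},\dots,\mathfrak X_{\sigma(k-1)},Q_{\rm II}(\mathfrak X_{\sigma(k)},\dots,\mathfrak X_{\sigma(k+q-1)},x_{k+q})\wedge y_{k+q},\mathfrak X_{k+q+1},\dots,\mathfrak X_{p+q}),$$ and $$(P\circ Q)_{\rm II}(\mathfrak X_1,\dots,\mathfrak X_{p+q},x)=\sum_{\sigma\in\mathbb S_{(p,q)}}(-1)^{pq}\mathrm{sign}(\sigma)P_{\rm II}(\mathfrak X_{\sigma(1)},\dots,\mathfrak X_{\sigma(p)},Q_{\rm II}(\mathfrak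 X_{\sigma(p+1)},\dots,\mathfrak X_{\sigma(p+q)},x))$$ $$+\sum_{k=1}^p(-1)^{(k-1)q}\sum_{\sigma\in\mathbb S_{(k-1,q)}}\mathrm{sign}(\sigma)P_{\rm II}(\mathfrak X_{\sigma(1)},\dots,\mathfrak X_{\sigma(k-1)},x_{k+q}\wedge Q_{\rm II}(\mathfrak X_{\sigma(k)},\dots,\mathfrak X_{\sigma(k+q-1)},y_{k+q}),\mathfrak X_{k+q+1},\dots,\mathfrak X_{p+q},x)$$ $$+\sum_{k=1}^p(-1)^{(k-1)q}\sum_{\sigma\in\mathbb S_{(k-1,q)}}\mathrm{sign}(\sigma)P_{\rm II}(\mathfrak X_{\sigma(1)},\dots,\mathfrak X_{\sigma(k-1)},Q_{\rm II}(\mathfrak X_{\sigma(k)},\dots,\mathfrak X_{\sigma(k+q-1)},x_{k+q})\wedge y_{k+q},\mathfrak X_{k+q+1},\dots,\mathfrak X_{p+q},x).$$ For $f,g\in\mathfrak C^0$ and $P\in\mathfrak C^p$ ($p\ge1$): $f\circ g$ is composition; $(f\circ P)_{\rm I}=f\circ P_{\rm I}$, $(f\circ P)_{\rm II}=f\circ P_{\rm II}$ (compositions); $(P\circ f)_{\rm I}(\mathfrak X_1,\dots,\mathfrak X_p)=\sum_{k=1}^pP_{\rm I}(\mathfrak X_1,\dots,\mathfrak X_{k-1},x_k\wedge f(y_k)+f(x_k)\wedge y_k,\mathfrak X_{k+1},\dots,\mathfrak X_p)$; $(P\circ f)_{\rm II}(\mathfrak X_1,\dots,\mathfrak X_p,x)=\sum_{k=1}^pP_{\rm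 II}(\mathfrak X_1,\dots,\mathfrak X_{k-1},x_k\wedge f(y_k)+f(x_k)\wedge y_k,\mathfrak X_{k+1},\dots,\mathfrak X_p,x)+P_{\rm II}(\mathfrak X_1,\dots,\mathfrak X_p,f(x))$. The bracket is $[P,Q]_{\mathsf{LieY}}=P\circ Q-(-1)^{pq}Q\circ P$. The operations $l_2,l_3$ on $C^*(V,\mathfrak g)=\bigoplus_{p\ge0}C^p(V,\mathfrak g)$: regard $C^p(V,\mathfrak g)$ as a subspace of $\mathfrak C^p(\mathfrak g\oplus V,\mathfrak g\oplus V)$ by precomposing with the projection $\mathfrak g\oplus V\to V$ in every argument. The projection $\mathrm{pr}_{\mathfrak g}:\mathfrak C^\bullet(\mathfrak g\oplus V,\mathfrak g\oplus V)\to C^*(V,\mathfrak g)$ restricts both components of a cochain to arguments in $V$ and projects the value to $\mathfrak g$. Let $\Delta\in\mathfrak C^1(\mathfrak g\oplus V,\mathfrak g\oplus V)$ be $\Delta_{\rm I}(x+u,y+v)=[x,y]+\rho(x)v-\rho(y)u$, $\Delta_{\rm II}(x+u,y+v,z+w)=[\![x,y,z]\!]+D(x,y)w+\mu(y,z)u-\mu(x,z)v$. Then $l_2(P,Q)=\mathrm{pr}_{\mathfrak g}[[\Delta,P]_{\mathsf{LieY}},Q]_{\mathsf{LieY}}$ and $l_3(P,Q,R)=\mathrm{pr}_{\mathfrak g}[[[\Delta,P]_{\mathsf{LieY}},Q]_{\mathsf{LieY}},R]_{\mathsf{LieY}}$.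
   Formalization: The sign (-1)^{n-1} for F in C^n(V,g), n≥1, is replaced by (-1)^n: with n the degree (C^0=Hom(V,g)) the printed sign is false (e.g. g=K with zero brackets, V=K^2, rho=0, mu(x,y)=xy·id, T a nonzero functional, n=1). *)

theory Defs
  imports "HOL-Analysis.Product_Vector" "HOL-Combinatorics.Permutations"
begin

section \<open>Lie-Yamaguti algebras, representations, relative Rota-Baxter operators\<close>

locale lie_yamaguti = vector_space sG
  for sG :: "'k::field_char_0 \<Rightarrow> 'g::ab_group_add \<Rightarrow> 'g" +
  fixes br :: "'g \<Rightarrow> 'g \<Rightarrow> 'g" and tr :: "'g \<Rightarrow> 'g \<Rightarrow> 'g \<Rightarrow> 'g"
  assumes br_linear_1: "Vector_Spaces.linear sG sG (\<lambda>x. br x y)"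
    and br_linear_2: "Vector_Spaces.linear sG sG (br x)"
    and br_alt: "br x x = 0"
    and tr_linear_1: "Vector_Spaces.linear sG sG (\<lambda>x. tr x y z)"
    and tr_linear_2: "Vector_Spaces.linear sG sG (\<lambda>y. tr x y z)"
    and tr_linear_3: "Vector_Spaces.linear sG sG (tr x y)"
    and tr_alt: "tr x x z = 0"
    and LY1: "br (br x y) z + br (br y z) x + br (br z x) y + tr x y z + tr y z x + tr z x y = 0"
    and LY2: "tr (br x y) z w + tr (br y z) x w + tr (br z x) y w = 0"
    and LY3: "tr x y (br z w) = br (tr x y z) w + br z (tr x y w)"
    and LY4: "tr x y (tr z w t) = tr (tr x y z) w t + tr z (tr x y w) t + tr z w (tr x y t)"

definition rep_D ::
  "('g \<Rightarrow> 'g \<Rightarrow> 'g) \<Rightarrow> ('g \<Rightarrow> 'v \<Rightarrow> 'v) \<Rightarrow> ('g \<Rightarrow> 'g \<Rightarrow> 'v \<Rightarrow> 'v) \<Rightarrow> 'g \<Rightarrow> 'g \<Rightarrow> 'v::ab_group_add \<Rightarrow> 'v"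
  where "rep_D br \<rho> \<mu> x y v =
    \<mu> y x v - \<mu> x y v + (\<rho> x (\<rho> y v) - \<rho> y (\<rho> x v)) - \<rho> (br x y) v"

locale lie_yamaguti_rep = lie_yamaguti sG br tr + V: vector_space sV
  for sG :: "'k::field_char_0 \<Rightarrow> 'g::ab_group_add \<Rightarrow> 'g"
    and br :: "'g \<Rightarrow> 'g \<Rightarrow> 'g" and tr :: "'g \<Rightarrow> 'g \<Rightarrow> 'g \<Rightarrow> 'g"
    and sV :: "'k \<Rightarrow> 'v::ab_group_add \<Rightarrow> 'v" +
  fixes \<rho> :: "'g \<Rightarrow> 'v \<Rightarrow> 'v" and \<mu> :: "'g \<Rightarrow> 'g \<Rightarrow> 'v \<Rightarrow> 'v"
  assumes rho_linear_1: "Vector_Spaces.linear sG sV (\<lambda>x. \<rho> x u)"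
    and rho_linear_2: "Vector_Spaces.linear sV sV (\<rho> x)"
    and mu_linear_1: "Vector_Spaces.linear sG sV (\<lambda>x. \<mu> x y u)"
    and mu_linear_2: "Vector_Spaces.linear sG sV (\<lambda>y. \<mu> x y u)"
    and mu_linear_3: "Vector_Spaces.linear sV sV (\<mu> x y)"
    and rep1: "\<mu> (br x y) z u - \<mu> x z (\<rho> y u) + \<mu> y z (\<rho> x u) = 0"
    and rep2: "\<mu> x (br y z) u - \<rho> y (\<mu> x z u) + \<rho> z (\<mu> x y u) = 0"
    and rep3: "\<rho> (tr x y z) u = rep_D br \<rho> \<mu> x y (\<rho> z u) - \<rho> z (rep_D br \<rho> \<mu> x y u)"
    and rep4: "\<mu> z w (\<mu> x y u) - \<mu> y w (\<mu> x z u) - \<mu> x (tr y z w) u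
                 + rep_D br \<rho> \<mu> y z (\<mu> x w u) = 0"
    and rep5: "\<mu> (tr x y z) w u + \<mu> z (tr x y w) u
                 = rep_D br \<rho> \<mu> x y (\<mu> z w u) - \<mu> z w (rep_D br \<rho> \<mu> x y u)"

definition sub_br :: "('g \<Rightarrow> 'v \<Rightarrow> 'v) \<Rightarrow> ('v \<Rightarrow> 'g) \<Rightarrow> 'v \<Rightarrow> 'v \<Rightarrow> 'v::ab_group_add"
  where "sub_br \<rho> T u v = \<rho> (T u) v - \<rho> (T v) u"

definition sub_tr ::
  "('g \<Rightarrow> 'g \<Rightarrow> 'g) \<Rightarrow> ('g \<Rightarrow> 'v \<Rightarrow> 'v) \<Rightarrow> ('g \<Rightarrow> 'g \<Rightarrow> 'v \<Rightarrow> 'v) \<Rightarrow> ('v \<Rightarrow> 'g)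
    \<Rightarrow> 'v \<Rightarrow> 'v \<Rightarrow> 'v \<Rightarrow> 'v::ab_group_add"
  where "sub_tr br \<rho> \<mu> T u v w =
    rep_D br \<rho> \<mu> (T u) (T v) w + \<mu> (T v) (T w) u - \<mu> (T u) (T w) v"

locale relative_rota_baxter = lie_yamaguti_rep sG br tr sV \<rho> \<mu>
  for sG :: "'k::field_char_0 \<Rightarrow> 'g::ab_group_add \<Rightarrow> 'g"
    and br :: "'g \<Rightarrow> 'g \<Rightarrow> 'g" and tr :: "'g \<Rightarrow> 'g \<Rightarrow> 'g \<Rightarrow> 'g"
    and sV :: "'k \<Rightarrow> 'v::ab_group_add \<Rightarrow> 'v"
    and \<rho> :: "'g \<Rightarrow> 'v \<Rightarrow> 'v" and \<mu> :: "'g \<Rightarrow> 'g \<Rightarrow> 'v \<Rightarrow> 'v" +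
  fixes T :: "'v \<Rightarrow> 'g"
  assumes T_linear: "Vector_Spaces.linear sV sG T"
    and RB_br: "br (T u) (T v) = T (sub_br \<rho> T u v)"
    and RB_tr: "tr (T u) (T v) (T w) = T (sub_tr br \<rho> \<mu> T u v w)"

definition varrho :: "('g \<Rightarrow> 'g \<Rightarrow> 'g) \<Rightarrow> ('g \<Rightarrow> 'v \<Rightarrow> 'v) \<Rightarrow> ('v \<Rightarrow> 'g) \<Rightarrow> 'v \<Rightarrow> 'g \<Rightarrow> 'g::ab_group_add"
  where "varrho br \<rho> T u x = br (T u) x + T (\<rho> x u)"

definition varpi ::
  "('g \<Rightarrow> 'g \<Rightarrow> 'g) \<Rightarrow> ('g \<Rightarrow> 'g \<Rightarrow> 'g \<Rightarrow> 'g) \<Rightarrow> ('g \<Rightarrow> 'v \<Rightarrow> 'v) \<Rightarrow> ('g \<Rightarrow> 'g \<Rightarrow> 'v \<Rightarrow> 'v) \<Rightarrow> ('v \<Rightarrow> 'g)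
    \<Rightarrow> 'v::ab_group_add \<Rightarrow> 'v \<Rightarrow> 'g \<Rightarrow> 'g::ab_group_add"
  where "varpi br tr \<rho> \<mu> T u v x =
    tr x (T u) (T v) - T (rep_D br \<rho> \<mu> x (T u) v - \<mu> x (T v) u)"


section \<open>Cochains\<close>

text \<open>
  A linear map on the \<open>p\<close>-th tensor power of \<open>\<Lambda>\<^sup>2 A\<close> is encoded by its values on tuples of
  decomposable bivectors: a function on lists of \<open>p\<close> pairs, the pair \<open>(x, y)\<close> standing for
  \<open>x \<and> y\<close>, which is linear in each of the \<open>2p\<close> entries and vanishes when the two entries of a
  pair coincide.  A sum of two decomposable bivectors in one argument becomes a sum of two values.
  Functions on such lists are extended by \<open>0\<close> to lists of any other length, so that equality
  of cochains is equality in HOL.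

  \<open>Hom f\<close> is a cochain of degree \<open>0\<close>; \<open>Cochain p P Q\<close>, with \<open>p \<ge> 1\<close>, is the cochain
  \<open>(P, Q)\<close> of degree \<open>p\<close>.
\<close>

datatype ('a, 'b) cochain =
    Hom "'a \<Rightarrow> 'b"
  | Cochain nat "('a \<times> 'a) list \<Rightarrow> 'b" "('a \<times> 'a) list \<Rightarrow> 'a \<Rightarrow> 'b"

definition mk_cochain ::
  "nat \<Rightarrow> (('a \<times> 'a) list \<Rightarrow> 'b) \<Rightarrow> (('a \<times> 'a) list \<Rightarrow> 'a \<Rightarrow> 'b) \<Rightarrow> ('a, 'b::zero) cochain"
  where "mk_cochain p P Q =
    Cochain p (\<lambda>X. if length X = p then P X else 0) (\<lambda>X x. if length X = p then Q X x else 0)"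

definition wedge_multilinear ::
  "('k::field \<Rightarrow> 'a \<Rightarrow> 'a) \<Rightarrow> ('k \<Rightarrow> 'b \<Rightarrow> 'b) \<Rightarrow> nat
    \<Rightarrow> (('a::ab_group_add \<times> 'a) list \<Rightarrow> 'b::ab_group_add) \<Rightarrow> bool"
  where "wedge_multilinear sA sB p f \<longleftrightarrow>
    (\<forall>X. length X \<noteq> p \<longrightarrow> f X = 0) \<and>
    (\<forall>X i. length X = p \<and> i < p \<longrightarrow>
      (\<forall>y. Vector_Spaces.linear sA sB (\<lambda>x. f (X[i := (x, y)]))) \<and>
      (\<forall>x. Vector_Spaces.linear sA sB (\<lambda>y. f (X[i := (x, y)]))) \<and>
      (\<forall>x. f (X[i := (x, x)]) = 0))"

definition cochains ::
  "('k::field \<Rightarrow> 'a \<Rightarrow> 'a) \<Rightarrow> ('k \<Rightarrow> 'b \<Rightarrow> 'b) \<Rightarrow> nat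
    \<Rightarrow> ('a::ab_group_add, 'b::ab_group_add) cochain set"
  where "cochains sA sB p =
    (if p = 0 then {Hom f | f. Vector_Spaces.linear sA sB f}
     else {Cochain p f g | f g.
       wedge_multilinear sA sB p f \<and>
       (\<forall>w. wedge_multilinear sA sB p (\<lambda>X. g X w)) \<and>
       (\<forall>X. length X = p \<longrightarrow> Vector_Spaces.linear sA sB (g X))})"

fun cochain_degree :: "('a, 'b) cochain \<Rightarrow> nat" where
  "cochain_degree (Hom f) = 0"
| "cochain_degree (Cochain p P Q) = p"

text \<open>The sum is meaningful for cochains of the same degree only.\<close>

fun cochain_add :: "('a, 'b) cochain \<Rightarrow> ('a, 'b) cochain \<Rightarrow> ('a, 'b::ab_group_add) cochain" where
  "cochain_add (Hom f) (Hom g) = Hom (\<lambda>x. f x + g x)"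
| "cochain_add (Cochain p P Q) (Cochain q P' Q') =
    Cochain p (\<lambda>X. P X + P' X) (\<lambda>X x. Q X x + Q' X x)"

fun cochain_scale :: "('k \<Rightarrow> 'b \<Rightarrow> 'b) \<Rightarrow> 'k \<Rightarrow> ('a, 'b) cochain \<Rightarrow> ('a, 'b) cochain" where
  "cochain_scale s c (Hom f) = Hom (\<lambda>x. s c (f x))"
| "cochain_scale s c (Cochain p P Q) = Cochain p (\<lambda>X. s c (P X)) (\<lambda>X x. s c (Q X x))"

text \<open>Arguments of cochains and the points permuted by shuffles are numbered from \<open>1\<close>.\<close>

definition arg :: "'a list \<Rightarrow> nat \<Rightarrow> 'a"
  where "arg X k = X ! (k - 1)"

definition omit :: "nat \<Rightarrow> 'a list \<Rightarrow> 'a list"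
  where "omit k X = take (k - 1) X @ drop k X"

definition replace :: "'a list \<Rightarrow> nat \<Rightarrow> 'a \<Rightarrow> 'a list"
  where "replace X k a = X[k - 1 := a]"

definition pick :: "'a list \<Rightarrow> (nat \<Rightarrow> nat) \<Rightarrow> nat \<Rightarrow> nat \<Rightarrow> 'a list"
  where "pick X \<sigma> i j = map (\<lambda>k. arg X (\<sigma> k)) [i..<Suc j]"


section \<open>The Yamaguti coboundary\<close>

text \<open>
  For a Lie-Yamaguti algebra with brackets \<open>br\<close>, \<open>tr\<close> and scalar multiplication \<open>s\<close> on the
  coefficient space of a representation \<open>(\<rho>, \<mu>)\<close>.  \<open>circ_sum tr \<phi> X k l\<close> is the value of \<open>\<phi>\<close> on
  \<open>X\<close> with the \<open>k\<close>-th entry omitted and the \<open>l\<close>-th entry replaced by \<open>X\<^sub>k \<circ> X\<^sub>l\<close>.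
\<close>

definition circ_sum ::
  "('v \<Rightarrow> 'v \<Rightarrow> 'v \<Rightarrow> 'v) \<Rightarrow> (('v \<times> 'v) list \<Rightarrow> 'g::ab_group_add) \<Rightarrow> ('v \<times> 'v) list \<Rightarrow> nat \<Rightarrow> nat \<Rightarrow> 'g"
  where "circ_sum tr \<phi> X k l =
    (case (arg X k, arg X l) of ((u\<^sub>k, v\<^sub>k), (u\<^sub>l, v\<^sub>l)) \<Rightarrow>
      \<phi> (omit k (replace X l (tr u\<^sub>k v\<^sub>k u\<^sub>l, v\<^sub>l))) + \<phi> (omit k (replace X l (u\<^sub>l, tr u\<^sub>k v\<^sub>k v\<^sub>l))))"

definition coboundary_I ::
  "('k::field \<Rightarrow> 'g \<Rightarrow> 'g) \<Rightarrow> ('v \<Rightarrow> 'v \<Rightarrow> 'v) \<Rightarrow> ('v \<Rightarrow> 'v \<Rightarrow> 'v \<Rightarrow> 'v)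
    \<Rightarrow> ('v \<Rightarrow> 'g \<Rightarrow> 'g) \<Rightarrow> ('v \<Rightarrow> 'v \<Rightarrow> 'g \<Rightarrow> 'g) \<Rightarrow> nat
    \<Rightarrow> (('v \<times> 'v) list \<Rightarrow> 'g) \<Rightarrow> (('v \<times> 'v) list \<Rightarrow> 'v \<Rightarrow> 'g) \<Rightarrow> ('v \<times> 'v) list \<Rightarrow> 'g::ab_group_add"
  where "coboundary_I s br tr \<rho> \<mu> n f g X =
    (case arg X (n + 1) of (u, v) \<Rightarrow>
      s ((-1) ^ n) (\<rho> u (g (take n X) v) - \<rho> v (g (take n X) u) - g (take n X) (br u v)))
    + (\<Sum>k = 1..n. s ((-1) ^ (k + 1))
        (rep_D br \<rho> \<mu> (fst (arg X k)) (snd (arg X k)) (f (omit k X))))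
    + (\<Sum>l = 1..n + 1. \<Sum>k = 1..<l. s ((-1) ^ k) (circ_sum tr f X k l))"

definition coboundary_II ::
  "('k::field \<Rightarrow> 'g \<Rightarrow> 'g) \<Rightarrow> ('v \<Rightarrow> 'v \<Rightarrow> 'v) \<Rightarrow> ('v \<Rightarrow> 'v \<Rightarrow> 'v \<Rightarrow> 'v)
    \<Rightarrow> ('v \<Rightarrow> 'g \<Rightarrow> 'g) \<Rightarrow> ('v \<Rightarrow> 'v \<Rightarrow> 'g \<Rightarrow> 'g) \<Rightarrow> nat
    \<Rightarrow> (('v \<times> 'v) list \<Rightarrow> 'v \<Rightarrow> 'g) \<Rightarrow> ('v \<times> 'v) list \<Rightarrow> 'v \<Rightarrow> 'g::ab_group_add"
  where "coboundary_II s br tr \<rho> \<mu> n g X w =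
    (case arg X (n + 1) of (u, v) \<Rightarrow>
      s ((-1) ^ n) (\<mu> v w (g (take n X) u) - \<mu> u w (g (take n X) v)))
    + (\<Sum>k = 1..n + 1. s ((-1) ^ (k + 1))
        (rep_D br \<rho> \<mu> (fst (arg X k)) (snd (arg X k)) (g (omit k X) w)))
    + (\<Sum>l = 1..n + 1. \<Sum>k = 1..<l. s ((-1) ^ k) (circ_sum tr (\<lambda>Y. g Y w) X k l))
    + (\<Sum>k = 1..n + 1. s ((-1) ^ k) (g (omit k X) (tr (fst (arg X k)) (snd (arg X k)) w)))"

fun coboundary ::
  "('k::field \<Rightarrow> 'g \<Rightarrow> 'g) \<Rightarrow> ('v \<Rightarrow> 'v \<Rightarrow> 'v) \<Rightarrow> ('v \<Rightarrow> 'v \<Rightarrow> 'v \<Rightarrow> 'v)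
    \<Rightarrow> ('v \<Rightarrow> 'g \<Rightarrow> 'g) \<Rightarrow> ('v \<Rightarrow> 'v \<Rightarrow> 'g \<Rightarrow> 'g)
    \<Rightarrow> ('v, 'g) cochain \<Rightarrow> ('v, 'g::ab_group_add) cochain" where
  "coboundary s br tr \<rho> \<mu> (Hom f) = mk_cochain 1
    (\<lambda>X. case arg X 1 of (u, v) \<Rightarrow> \<rho> u (f v) - \<rho> v (f u) - f (br u v))
    (\<lambda>X w. case arg X 1 of (u, v) \<Rightarrow>
      rep_D br \<rho> \<mu> u v (f w) + \<mu> v w (f u) - \<mu> u w (f v) - f (tr u v w))"
| "coboundary s br tr \<rho> \<mu> (Cochain n f g) = mk_cochain (n + 1)
    (coboundary_I s br tr \<rho> \<mu> n f g) (coboundary_II s br tr \<rho> \<mu> n g)"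

definition rb_coboundary ::
  "('k::field \<Rightarrow> 'g \<Rightarrow> 'g) \<Rightarrow> ('g \<Rightarrow> 'g \<Rightarrow> 'g) \<Rightarrow> ('g \<Rightarrow> 'g \<Rightarrow> 'g \<Rightarrow> 'g)
    \<Rightarrow> ('g \<Rightarrow> 'v \<Rightarrow> 'v) \<Rightarrow> ('g \<Rightarrow> 'g \<Rightarrow> 'v \<Rightarrow> 'v) \<Rightarrow> ('v \<Rightarrow> 'g)
    \<Rightarrow> ('v::ab_group_add, 'g) cochain \<Rightarrow> ('v, 'g::ab_group_add) cochain"
  where "rb_coboundary sG br tr \<rho> \<mu> T =
    coboundary sG (sub_br \<rho> T) (sub_tr br \<rho> \<mu> T) (varrho br \<rho> T) (varpi br tr \<rho> \<mu> T)"


section \<open>The graded Lie algebra of a vector space\<close>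

definition shuffle_perms :: "nat \<Rightarrow> nat \<Rightarrow> (nat \<Rightarrow> nat) set"
  where "shuffle_perms i j =
    {\<sigma>. \<sigma> permutes {1..i + j} \<and> strict_mono_on {1..i} \<sigma> \<and> strict_mono_on {i + 1..i + j} \<sigma>}"

text \<open>
  The two sums over \<open>k\<close> common to both components of \<open>P \<circ> Q\<close>, with \<open>\<phi>\<close> for \<open>P\<^sub>I\<close>, respectively
  for \<open>P\<^sub>I\<^sub>I\<close> at a fixed last argument.
\<close>

definition insertion_sum ::
  "('k::field \<Rightarrow> 'e \<Rightarrow> 'e) \<Rightarrow> nat \<Rightarrow> nat \<Rightarrow> (('e \<times> 'e) list \<Rightarrow> 'e)
    \<Rightarrow> (('e \<times> 'e) list \<Rightarrow> 'e \<Rightarrow> 'e) \<Rightarrow> ('e \<times> 'e) list \<Rightarrow> 'e::ab_group_add"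
  where "insertion_sum s p q \<phi> Q\<^sub>I\<^sub>I X =
    (\<Sum>k = 1..p. s ((-1) ^ ((k - 1) * q)) (\<Sum>\<sigma>\<in>shuffle_perms (k - 1) q. s (of_int (sign \<sigma>))
      (case arg X (k + q) of (x, y) \<Rightarrow>
        \<phi> (pick X \<sigma> 1 (k - 1) @ [(x, Q\<^sub>I\<^sub>I (pick X \<sigma> k (k + q - 1)) y)] @ drop (k + q) X))))
  + (\<Sum>k = 1..p. s ((-1) ^ ((k - 1) * q)) (\<Sum>\<sigma>\<in>shuffle_perms (k - 1) q. s (of_int (sign \<sigma>))
      (case arg X (k + q) of (x, y) \<Rightarrow>
        \<phi> (pick X \<sigma> 1 (k - 1) @ [(Q\<^sub>I\<^sub>I (pick X \<sigma> k (k + q - 1)) x, y)] @ drop (k + q) X))))"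

definition derivation_sum ::
  "nat \<Rightarrow> (('e \<times> 'e) list \<Rightarrow> 'e) \<Rightarrow> ('e \<Rightarrow> 'e) \<Rightarrow> ('e \<times> 'e) list \<Rightarrow> 'e::ab_group_add"
  where "derivation_sum p \<phi> f X =
    (\<Sum>k = 1..p. case arg X k of (x, y) \<Rightarrow> \<phi> (replace X k (x, f y)) + \<phi> (replace X k (f x, y)))"

fun cochain_comp ::
  "('k::field \<Rightarrow> 'e \<Rightarrow> 'e) \<Rightarrow> ('e, 'e) cochain \<Rightarrow> ('e, 'e) cochain \<Rightarrow> ('e, 'e::ab_group_add) cochain"
where
  "cochain_comp s (Hom f) (Hom g) = Hom (f \<circ> g)"
| "cochain_comp s (Hom f) (Cochain q Q\<^sub>I Q\<^sub>I\<^sub>I) =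
    mk_cochain q (\<lambda>X. f (Q\<^sub>I X)) (\<lambda>X x. f (Q\<^sub>I\<^sub>I X x))"
| "cochain_comp s (Cochain p P\<^sub>I P\<^sub>I\<^sub>I) (Hom f) = mk_cochain p
    (derivation_sum p P\<^sub>I f)
    (\<lambda>X x. derivation_sum p (\<lambda>Y. P\<^sub>I\<^sub>I Y x) f X + P\<^sub>I\<^sub>I X (f x))"
| "cochain_comp s (Cochain p P\<^sub>I P\<^sub>I\<^sub>I) (Cochain q Q\<^sub>I Q\<^sub>I\<^sub>I) = mk_cochain (p + q)
    (\<lambda>X. (\<Sum>\<sigma>\<in>{\<sigma> \<in> shuffle_perms p q. \<sigma> (p + q) = p + q}. s ((-1) ^ (p * q) * of_int (sign \<sigma>))
            (P\<^sub>I\<^sub>I (pick X \<sigma> 1 p) (Q\<^sub>I (pick X \<sigma> (p + 1) (p + q)))))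
         + insertion_sum s p q P\<^sub>I Q\<^sub>I\<^sub>I X)
    (\<lambda>X x. (\<Sum>\<sigma>\<in>shuffle_perms p q. s ((-1) ^ (p * q) * of_int (sign \<sigma>))
            (P\<^sub>I\<^sub>I (pick X \<sigma> 1 p) (Q\<^sub>I\<^sub>I (pick X \<sigma> (p + 1) (p + q)) x)))
         + insertion_sum s p q (\<lambda>Y. P\<^sub>I\<^sub>I Y x) Q\<^sub>I\<^sub>I X)"

definition LieY_bracket ::
  "('k::field \<Rightarrow> 'e \<Rightarrow> 'e) \<Rightarrow> ('e, 'e) cochain \<Rightarrow> ('e, 'e) cochain \<Rightarrow> ('e, 'e::ab_group_add) cochain"
  where "LieY_bracket s P Q =
    cochain_add (cochain_comp s P Q)
      (cochain_scale s (- ((-1) ^ (cochain_degree P * cochain_degree Q))) (cochain_comp s Q P))"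


section \<open>The operations on cochains of V with values in g\<close>

text \<open>The direct sum of \<open>\<gg>\<close> and \<open>V\<close> is the product type \<open>'g \<times> 'v\<close>.\<close>

fun lift_cochain :: "('v, 'g) cochain \<Rightarrow> ('g \<times> 'v, 'g \<times> 'v::zero) cochain" where
  "lift_cochain (Hom f) = Hom (\<lambda>e. (f (snd e), 0))"
| "lift_cochain (Cochain p f g) = Cochain p
    (\<lambda>X. (f (map (map_prod snd snd) X), 0))
    (\<lambda>X e. (g (map (map_prod snd snd) X) (snd e), 0))"

fun pr_cochain :: "('g \<times> 'v, 'g \<times> 'v) cochain \<Rightarrow> ('v, 'g::zero) cochain" where
  "pr_cochain (Hom f) = Hom (\<lambda>v. fst (f (0, v)))"
| "pr_cochain (Cochain p P Q) = Cochain p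
    (\<lambda>X. fst (P (map (map_prod (Pair 0) (Pair 0)) X)))
    (\<lambda>X w. fst (Q (map (map_prod (Pair 0) (Pair 0)) X) (0, w)))"

definition Delta ::
  "('g \<Rightarrow> 'g \<Rightarrow> 'g) \<Rightarrow> ('g \<Rightarrow> 'g \<Rightarrow> 'g \<Rightarrow> 'g) \<Rightarrow> ('g \<Rightarrow> 'v \<Rightarrow> 'v) \<Rightarrow> ('g \<Rightarrow> 'g \<Rightarrow> 'v \<Rightarrow> 'v)
    \<Rightarrow> ('g \<times> 'v, 'g::ab_group_add \<times> 'v::ab_group_add) cochain"
  where "Delta br tr \<rho> \<mu> = mk_cochain 1
    (\<lambda>X. case arg X 1 of ((x, u), (y, v)) \<Rightarrow> (br x y, \<rho> x v - \<rho> y u))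
    (\<lambda>X (z, w). case arg X 1 of ((x, u), (y, v)) \<Rightarrow>
      (tr x y z, rep_D br \<rho> \<mu> x y w + \<mu> y z u - \<mu> x z v))"

definition l2 ::
  "('k::field \<Rightarrow> 'g \<Rightarrow> 'g) \<Rightarrow> ('k \<Rightarrow> 'v \<Rightarrow> 'v)
    \<Rightarrow> ('g \<Rightarrow> 'g \<Rightarrow> 'g) \<Rightarrow> ('g \<Rightarrow> 'g \<Rightarrow> 'g \<Rightarrow> 'g) \<Rightarrow> ('g \<Rightarrow> 'v \<Rightarrow> 'v) \<Rightarrow> ('g \<Rightarrow> 'g \<Rightarrow> 'v \<Rightarrow> 'v)
    \<Rightarrow> ('v, 'g) cochain \<Rightarrow> ('v, 'g) cochain \<Rightarrow> ('v::ab_group_add, 'g::ab_group_add) cochain"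
  where "l2 sG sV br tr \<rho> \<mu> P Q =
    (let L = LieY_bracket (module_prod.scale sG sV) in
      pr_cochain (L (L (Delta br tr \<rho> \<mu>) (lift_cochain P)) (lift_cochain Q)))"

definition l3 ::
  "('k::field \<Rightarrow> 'g \<Rightarrow> 'g) \<Rightarrow> ('k \<Rightarrow> 'v \<Rightarrow> 'v)
    \<Rightarrow> ('g \<Rightarrow> 'g \<Rightarrow> 'g) \<Rightarrow> ('g \<Rightarrow> 'g \<Rightarrow> 'g \<Rightarrow> 'g) \<Rightarrow> ('g \<Rightarrow> 'v \<Rightarrow> 'v) \<Rightarrow> ('g \<Rightarrow> 'g \<Rightarrow> 'v \<Rightarrow> 'v)
    \<Rightarrow> ('v, 'g) cochain \<Rightarrow> ('v, 'g) cochain \<Rightarrow> ('v, 'g) cochain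
    \<Rightarrow> ('v::ab_group_add, 'g::ab_group_add) cochain"
  where "l3 sG sV br tr \<rho> \<mu> P Q R =
    (let L = LieY_bracket (module_prod.scale sG sV) in
      pr_cochain (L (L (L (Delta br tr \<rho> \<mu>) (lift_cochain P)) (lift_cochain Q)) (lift_cochain R)))"

text \<open>
  On cochains of degree \<open>n\<close> the operator below differs from the Yamaguti coboundary by the sign
  \<open>(-1) ^ n\<close>; this is \<open>(-1) ^ (N - 1)\<close> for Yamaguti's index \<open>N = n + 1\<close>, in which cochains of
  degree \<open>n\<close> are called \<open>N\<close>-cochains.
\<close>

definition l1_twisted ::
  "('k::field \<Rightarrow> 'g \<Rightarrow> 'g) \<Rightarrow> ('k \<Rightarrow> 'v \<Rightarrow> 'v)
    \<Rightarrow> ('g \<Rightarrow> 'g \<Rightarrow> 'g) \<Rightarrow> ('g \<Rightarrow> 'g \<Rightarrow> 'g \<Rightarrow> 'g) \<Rightarrow> ('g \<Rightarrow> 'v \<Rightarrow> 'v) \<Rightarrow> ('g \<Rightarrow> 'g \<Rightarrow> 'v \<Rightarrow> 'v)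
    \<Rightarrow> ('v \<Rightarrow> 'g) \<Rightarrow> ('v, 'g) cochain \<Rightarrow> ('v::ab_group_add, 'g::ab_group_add) cochain"
  where "l1_twisted sG sV br tr \<rho> \<mu> T P =
    cochain_add (l2 sG sV br tr \<rho> \<mu> (Hom T) P)
      (cochain_scale sG (1 / 2) (l3 sG sV br tr \<rho> \<mu> (Hom T) (Hom T) P))"

end

theory Submission
  imports Defs
begin

text \<open>
  By linearity \<open>l\<^sub>1\<^sup>T F\<close> is the projection of \<open>[\<Theta>, F]\<close> with \<open>\<Theta> = [\<Delta>, T] + [[\<Delta>, T], T] / 2\<close>, a
  cochain of degree 1.  Since \<open>F\<close> only sees the \<open>V\<close>-parts of its arguments and takes values in \<open>\<gg>\<close>,
  only a few components of \<open>\<Theta>\<close> matter.  Counting occurrences of \<open>T\<close> shows that those of the binary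
  part come from \<open>[\<Delta>, T]\<close> alone and are \<open>[u, v]\<^sub>T\<close> and \<open>\<varrho>\<close>, while those of the ternary part come from
  \<open>[[\<Delta>, T], T] / 2\<close> alone and are the ternary bracket of \<open>T\<close>, \<open>D\<close> and \<open>\<plusminus>\<varpi>\<close>.  The shuffles in a bracket
  with a cochain of degree 1 are the cycles moving one point to the first or to the last place,
  and their signs are those of the coboundary, up to the global sign \<open>(-1) ^ n\<close>.
\<close>

section \<open>Shuffles with a block of length at most one\<close>

text \<open>For \<open>1 \<le> j \<le> Suc n\<close> this is the cycle sending the last point of
  \<open>{1..Suc n}\<close> to \<open>j\<close> and keeping the order of the others: the
  \<open>(n, 1)\<close>-shuffle with value \<open>j\<close> at \<open>Suc n\<close>. Dually,
  \<open>cyc_first k\<close> sends \<open>1\<close> to \<open>k\<close> and is a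
  \<open>(1, n)\<close>-shuffle whenever \<open>1 \<le> k \<le> Suc n\<close>.\<close>

definition cyc_last :: "nat \<Rightarrow> nat \<Rightarrow> nat \<Rightarrow> nat"
  where "cyc_last n j i = (if i < j then i else if i \<le> n then Suc i else if i = Suc n then j else i)"

definition cyc_first :: "nat \<Rightarrow> nat \<Rightarrow> nat"
  where "cyc_first k i = (if i = 1 then k else if i \<le> k then i - 1 else i)"

lemma cyc_last_Suc: "j \<le> n \<Longrightarrow> cyc_last n j = transpose j (Suc j) \<circ> cyc_last n (Suc j)"
  by (auto simp: fun_eq_iff cyc_last_def transpose_def)

lemma cyc_last_id: "cyc_last n (Suc n) = id"
  by (auto simp: fun_eq_iff cyc_last_def)

text \<open>Descending induction on \<open>j\<close> from the identity at \<open>j = Suc n\<close>: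
  each step composes with one adjacent transposition, which flips the sign.\<close>

lemma cyc_last_permutes_sign:
  assumes "1 \<le> j" "j \<le> Suc n"
  shows "cyc_last n j permutes {1..Suc n} \<and> sign (cyc_last n j) = (-1) ^ (Suc n - j)"
  using assms(2,1)
proof (induction rule: inc_induct)
  case base
  show ?case unfolding cyc_last_id by (rule conjI, rule permutes_id, simp add: sign_id)
next
  case (step j)
  then have IH: "cyc_last n (Suc j) permutes {1..Suc n}" "sign (cyc_last n (Suc j)) = (-1) ^ (n - j)"
    by simp_all
  have tr: "transpose j (Suc j) permutes {1..Suc n}"
    using step by (intro permutes_swap_id) auto
  have perm: "permutation (cyc_last n (Suc j))" "permutation (transpose j (Suc j))"
    using IH(1) tr permutation_permutes by blast+
  have eq: "cyc_last n j = transpose j (Suc j) \<circ> cyc_last n (Suc j)"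
    using step.hyps by (intro cyc_last_Suc) simp
  have "sign (cyc_last n j) = - ((-1) ^ (n - j))"
    unfolding eq sign_compose[OF perm(2,1)] IH(2) by (simp add: sign_swap_id)
  also have "\<dots> = (-1) ^ (Suc n - j)"
    using step.hyps by (simp add: Suc_diff_le)
  finally show ?case
    using permutes_compose[OF IH(1) tr] unfolding eq by blast
qed

lemma cyc_first_1: "cyc_first (Suc 0) = id"
  by (auto simp: fun_eq_iff cyc_first_def)

lemma cyc_first_Suc: "1 \<le> k \<Longrightarrow> cyc_first (Suc k) = transpose k (Suc k) \<circ> cyc_first k"
  by (auto simp: fun_eq_iff cyc_first_def transpose_def)

lemma cyc_first_permutes_sign:
  assumes "1 \<le> k"
  shows "k \<le> Suc n \<Longrightarrow> cyc_first k permutes {1..Suc n} \<and> sign (cyc_first k) = (-1) ^ (k - 1)"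
  using assms
proof (induction k rule: dec_induct)
  case base
  show ?case unfolding One_nat_def cyc_first_1 by (rule conjI, rule permutes_id, simp add: sign_id)
next
  case (step k)
  then have IH: "cyc_first k permutes {1..Suc n}" "sign (cyc_first k) = (-1) ^ (k - 1)"
    by simp_all
  have tr: "transpose k (Suc k) permutes {1..Suc n}"
    using step by (intro permutes_swap_id) auto
  have perm: "permutation (cyc_first k)" "permutation (transpose k (Suc k))"
    using IH(1) tr permutation_permutes by blast+
  have eq: "cyc_first (Suc k) = transpose k (Suc k) \<circ> cyc_first k"
    using step.hyps by (intro cyc_first_Suc) simp
  have "sign (cyc_first (Suc k)) = - ((-1) ^ (k - 1))"
    unfolding eq sign_compose[OF perm(2,1)] IH(2) by (simp add: sign_swap_id)
  also have "\<dots> = (-1) ^ (Suc k - 1)"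
    using step.hyps by (cases k) auto
  finally show ?case
    using permutes_compose[OF IH(1) tr] unfolding eq by blast
qed

section \<open>Classification of these shuffles and sums over them\<close>

lemma strict_mono_on_unique:
  fixes \<sigma> \<tau> :: "nat \<Rightarrow> nat"
  assumes "strict_mono_on {a..b} \<sigma>" "strict_mono_on {a..b} \<tau>" "\<sigma> ` {a..b} = \<tau> ` {a..b}" "i \<in> {a..b}"
  shows "\<sigma> i = \<tau> i"
proof -
  \<comment> \<open>A strictly increasing map lists its values in sorted order, and a strictly
    sorted list is determined by its set of entries.\<close>
  have *: "sorted_wrt (<) (map f [a..<Suc b])" if "strict_mono_on {a..b} f" for f :: "nat \<Rightarrow> nat"
    using that unfolding sorted_wrt_iff_nth_less strict_mono_on_def
    by (clarsimp simp del: upt_Suc) (auto simp: less_diff_conv)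
  have "map \<sigma> [a..<Suc b] = map \<tau> [a..<Suc b]"
    using assms(3)
    by (intro strict_sorted_equal *[OF assms(1)] *[OF assms(2)])
       (simp add: atLeastLessThanSuc_atLeastAtMost del: upt_Suc)
  then show ?thesis
    using assms(4) by (simp del: upt_Suc)
qed

lemma shuffle_perms_0: "shuffle_perms 0 n = {id}"
proof
  show "shuffle_perms 0 n \<subseteq> {id}"
  proof
    fix \<sigma> assume "\<sigma> \<in> shuffle_perms 0 n"
    then have \<sigma>: "\<sigma> permutes {1..n}" "strict_mono_on {1..n} \<sigma>"
      by (auto simp: shuffle_perms_def)
    have "\<sigma> i = i" for i
      using strict_mono_on_unique[OF \<sigma>(2), of id i] \<sigma>(1) permutes_image[OF \<sigma>(1)]
      by (cases "i \<in> {1..n}") (auto simp: strict_mono_on_def permutes_not_in)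
    then show "\<sigma> \<in> {id}" by auto
  qed
qed (auto simp: shuffle_perms_def permutes_id strict_mono_on_def)

text \<open>An \<open>(n, 1)\<close>-shuffle increases on \<open>{1..n}\<close>, so its value at
  \<open>Suc n\<close>, which can be any point, determines it.\<close>

lemma sum_shuffle_perms_last:
  "(\<Sum>\<sigma>\<in>shuffle_perms n 1. h \<sigma>) = (\<Sum>j = 1..Suc n. h (cyc_last n j))"
proof (rule sum.reindex_bij_witness[where i = "cyc_last n" and j = "\<lambda>\<sigma>. \<sigma> (Suc n)"])
  fix \<sigma> assume "\<sigma> \<in> shuffle_perms n 1"
  then have \<sigma>: "\<sigma> permutes {1..Suc n}" "strict_mono_on {1..n} \<sigma>"
    by (auto simp: shuffle_perms_def)
  show j: "\<sigma> (Suc n) \<in> {1..Suc n}"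
    using permutes_in_image[OF \<sigma>(1)] by auto
  \<comment> \<open>The cycle with the same last value as \<open>\<sigma>\<close>. On
    \<open>{1..n}\<close> both increase and have the same image, the complement of that
    value.\<close>
  define \<tau> where "\<tau> = cyc_last n (\<sigma> (Suc n))"
  have \<tau>: "\<tau> permutes {1..Suc n}" "strict_mono_on {1..n} \<tau>" "\<tau> (Suc n) = \<sigma> (Suc n)"
    using j cyc_last_permutes_sign[of "\<sigma> (Suc n)" n]
    by (auto simp: \<tau>_def cyc_last_def strict_mono_on_def)
  have img: "f ` {1..n} = {1..Suc n} - {f (Suc n)}" if "f permutes {1..Suc n}" for f :: "nat \<Rightarrow> nat"
  proof -
    have "f ` ({1..Suc n} - {Suc n}) = f ` {1..Suc n} - f ` {Suc n}"
      by (rule image_set_diff) (rule permutes_inj[OF that])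
    moreover have "{1..Suc n} - {Suc n} = {1..n}" by auto
    ultimately show ?thesis using permutes_image[OF that] by simp
  qed
  have "\<tau> i = \<sigma> i" for i
  proof (cases "i \<in> {1..n}")
    case True
    then show ?thesis
      by (intro strict_mono_on_unique[OF \<tau>(2) \<sigma>(2)]) (simp_all only: img[OF \<tau>(1)] img[OF \<sigma>(1)] \<tau>(3))
  next
    case False
    then show ?thesis
      using \<tau>(3) permutes_not_in[OF \<tau>(1), of i] permutes_not_in[OF \<sigma>(1), of i]
      by (cases "i = Suc n") auto
  qed
  then show "cyc_last n (\<sigma> (Suc n)) = \<sigma>"
    by (auto simp: \<tau>_def)
  then show "h (cyc_last n (\<sigma> (Suc n))) = h \<sigma>" by simp
next
  fix j assume j: "j \<in> {1..Suc n}"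
  then show "cyc_last n j (Suc n) = j" by (auto simp: cyc_last_def)
  show "cyc_last n j \<in> shuffle_perms n 1"
    using j cyc_last_permutes_sign[of j n]
    by (auto simp: shuffle_perms_def strict_mono_on_def cyc_last_def)
qed

lemma sum_shuffle_perms_first:
  "(\<Sum>\<sigma>\<in>shuffle_perms 1 n. h \<sigma>) = (\<Sum>k = 1..Suc n. h (cyc_first k))"
proof (rule sum.reindex_bij_witness[where i = cyc_first and j = "\<lambda>\<sigma>. \<sigma> 1"])
  fix \<sigma> assume "\<sigma> \<in> shuffle_perms 1 n"
  then have \<sigma>: "\<sigma> permutes {1..Suc n}" "strict_mono_on {2..Suc n} \<sigma>"
    by (auto simp: shuffle_perms_def numeral_2_eq_2)
  show j: "\<sigma> 1 \<in> {1..Suc n}"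
    using permutes_in_image[OF \<sigma>(1)] by auto
  define \<tau> where "\<tau> = cyc_first (\<sigma> 1)"
  have \<tau>: "\<tau> permutes {1..Suc n}" "strict_mono_on {2..Suc n} \<tau>" "\<tau> 1 = \<sigma> 1"
    using j cyc_first_permutes_sign[of "\<sigma> 1" n]
    by (auto simp: \<tau>_def cyc_first_def strict_mono_on_def)
  have img: "f ` {2..Suc n} = {1..Suc n} - {f 1}" if "f permutes {1..Suc n}" for f :: "nat \<Rightarrow> nat"
  proof -
    have "f ` ({1..Suc n} - {1}) = f ` {1..Suc n} - f ` {1}"
      by (rule image_set_diff) (rule permutes_inj[OF that])
    moreover have "{1..Suc n} - {1} = {2..Suc n}" by auto
    ultimately show ?thesis using permutes_image[OF that] by simp
  qed
  have "\<tau> i = \<sigma> i" for i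
  proof (cases "i \<in> {2..Suc n}")
    case True
    then show ?thesis
      by (intro strict_mono_on_unique[OF \<tau>(2) \<sigma>(2)]) (simp_all only: img[OF \<tau>(1)] img[OF \<sigma>(1)] \<tau>(3))
  next
    case False
    then show ?thesis
      using \<tau>(3) permutes_not_in[OF \<tau>(1), of i] permutes_not_in[OF \<sigma>(1), of i]
      by (cases "i = 1") auto
  qed
  then show "cyc_first (\<sigma> 1) = \<sigma>"
    by (auto simp: \<tau>_def)
  then show "h (cyc_first (\<sigma> 1)) = h \<sigma>" by simp
next
  fix k assume k: "k \<in> {1..Suc n}"
  then show "cyc_first k 1 = k" by (auto simp: cyc_first_def)
  show "cyc_first k \<in> shuffle_perms 1 n"
    using k cyc_first_permutes_sign[of k n]
    by (auto simp: shuffle_perms_def strict_mono_on_def cyc_first_def)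
qed

lemma sum_shuffle_perms_last_fixed:
  "(\<Sum>\<sigma>\<in>{\<sigma> \<in> shuffle_perms n 1. \<sigma> (Suc n) = Suc n}. h \<sigma>) = h id"
proof -
  have fin: "finite (shuffle_perms n 1)"
    by (rule finite_subset[OF _ finite_permutations[of "{1..n + 1}"]]) (auto simp: shuffle_perms_def)
  have "(\<Sum>\<sigma>\<in>{\<sigma> \<in> shuffle_perms n 1. \<sigma> (Suc n) = Suc n}. h \<sigma>)
      = (\<Sum>\<sigma>\<in>shuffle_perms n 1. if \<sigma> (Suc n) = Suc n then h \<sigma> else 0)"
    using fin by (simp add: sum.inter_filter)
  also have "\<dots> = (\<Sum>j = 1..Suc n. if j = Suc n then h (cyc_last n j) else 0)"
    unfolding sum_shuffle_perms_last by (intro sum.cong) (auto simp: cyc_last_def)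
  also have "\<dots> = h id" by (simp add: cyc_last_id)
  finally show ?thesis .
qed

text \<open>The condition discards exactly \<open>cyc_first (Suc n)\<close>. For
  \<open>n = 0\<close> this cycle is the identity and would survive, hence
  \<open>1 \<le> n\<close>.\<close>

lemma sum_shuffle_perms_first_fixed:
  assumes "1 \<le> n"
  shows "(\<Sum>\<sigma>\<in>{\<sigma> \<in> shuffle_perms 1 n. \<sigma> (Suc n) = Suc n}. h \<sigma>) = (\<Sum>k = 1..n. h (cyc_first k))"
proof -
  have fin: "finite (shuffle_perms 1 n)"
    by (rule finite_subset[OF _ finite_permutations[of "{1..1 + n}"]]) (auto simp: shuffle_perms_def)
  have "(\<Sum>\<sigma>\<in>{\<sigma> \<in> shuffle_perms 1 n. \<sigma> (Suc n) = Suc n}. h \<sigma>)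
      = (\<Sum>\<sigma>\<in>shuffle_perms 1 n. if \<sigma> (Suc n) = Suc n then h \<sigma> else 0)"
    using fin by (simp add: sum.inter_filter)
  also have "\<dots> = (\<Sum>k = 1..Suc n. if k \<le> n then h (cyc_first k) else 0)"
    unfolding sum_shuffle_perms_first using assms by (intro sum.cong) (auto simp: cyc_first_def)
  also have "\<dots> = (\<Sum>k = 1..n. h (cyc_first k))"
    by (simp add: sum.cl_ivl_Suc)
  finally show ?thesis .
qed

section \<open>Arguments read off along the cycles\<close>

lemma pick_id: "i \<le> length X \<Longrightarrow> pick X id 1 i = take i X"
  by (rule nth_equalityI) (auto simp: pick_def arg_def simp del: upt_Suc)

text \<open>The list may be longer than \<open>Suc n\<close>, because an insertion sum shuffles only
  a prefix of the arguments.\<close>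

lemma pick_cyc_last:
  assumes "1 \<le> j" "j \<le> Suc n" "n < length X"
  shows "pick X (cyc_last n j) 1 n = omit j (take (Suc n) X)"
  using assms
  by (intro nth_equalityI)
     (auto simp: pick_def arg_def omit_def cyc_last_def nth_append min_def simp del: upt_Suc)

lemma pick_cyc_last_Suc:
  "j \<le> Suc n \<Longrightarrow> pick X (cyc_last n j) (Suc n) (Suc n) = [arg X j]"
  by (auto simp: pick_def cyc_last_def)

lemma pick_cyc_first_1: "pick X (cyc_first k) 1 1 = [arg X k]"
  by (simp add: pick_def cyc_first_def)

lemma pick_cyc_first:
  assumes "1 \<le> k" "k \<le> Suc n" "length X = Suc n"
  shows "pick X (cyc_first k) 2 (Suc n) = omit k X"
  using assms
  by (intro nth_equalityI)
     (auto simp: pick_def arg_def omit_def cyc_first_def nth_append min_def simp del: upt_Suc)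

lemma omit_replace:
  assumes "1 \<le> j" "j \<le> k" "k < length X"
  shows "omit j (take k X) @ [a] @ drop (Suc k) X = omit j (replace X (Suc k) a)"
proof -
  have "replace X (Suc k) a = take k X @ a # drop (Suc k) X"
    using assms by (simp add: replace_def upd_conv_take_nth_drop)
  with assms show ?thesis
    by (simp add: omit_def)
qed

section \<open>Compositions with a cochain of degree one\<close>

context vector_space
begin

text \<open>For \<open>p = 1\<close> only \<open>k = 1\<close> occurs, and its shuffles have an
  empty first block, so only the identity contributes.\<close>

lemma insertion_sum_single_left:
  assumes "length X = Suc n"
  shows "insertion_sum scale 1 n \<phi> Q X
    = (case arg X (Suc n) of (x, y) \<Rightarrow> \<phi> [(x, Q (take n X) y)] + \<phi> [(Q (take n X) x, y)])"
  using assms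
  by (simp add: insertion_sum_def shuffle_perms_0 pick_id[unfolded One_nat_def] sign_id split: prod.split)

text \<open>In summand \<open>k\<close> the cycle with last value \<open>j \<le> k\<close> takes
  entry \<open>j\<close> out of the first \<open>k\<close> entries and lets it act on entry
  \<open>l = k + 1\<close>. The sign is \<open>(-1) ^ (k - 1)\<close> times
  \<open>(-1) ^ (k - j)\<close>, that is \<open>(-1) ^ Suc j\<close>.\<close>

lemma insertion_sum_single_right:
  assumes "length X = Suc n"
  shows "insertion_sum scale n 1 \<phi> Q X
    = (\<Sum>l = 1..Suc n. \<Sum>j = 1..<l. scale ((-1) ^ Suc j) (circ_sum (\<lambda>a b. Q [(a, b)]) \<phi> X j l))"
proof -
  define t where "t j a k = \<phi> (omit j (replace X (Suc k) a))" for j a k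
  \<comment> \<open>\<open>G\<close> stands for the pair that receives the value of
    \<open>Q\<close>, so one computation serves insertion into either entry of the pair.\<close>
  have summand: "scale ((-1) ^ ((k - 1) * 1)) (\<Sum>\<sigma>\<in>shuffle_perms (k - 1) 1. scale (of_int (sign \<sigma>))
      (\<phi> (pick X \<sigma> 1 (k - 1) @ [G (pick X \<sigma> k (k + 1 - 1))] @ drop (k + 1) X)))
    = (\<Sum>j = 1..<Suc k. scale ((-1) ^ Suc j) (\<phi> (omit j (replace X (Suc k) (G [arg X j])))))"
    if k1: "k \<in> {1..n}" for k and G :: "('b \<times> 'b) list \<Rightarrow> 'b \<times> 'b"
  proof -
    obtain m where k: "k = Suc m" using k1 by (cases k) auto
    have "scale ((-1) ^ m) (\<Sum>\<sigma>\<in>shuffle_perms m 1. scale (of_int (sign \<sigma>))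
        (\<phi> (pick X \<sigma> 1 m @ [G (pick X \<sigma> (Suc m) (Suc m))] @ drop (Suc k) X)))
      = (\<Sum>j = 1..Suc m. scale ((-1) ^ m) (scale (of_int (sign (cyc_last m j)))
        (\<phi> (pick X (cyc_last m j) 1 m @ [G (pick X (cyc_last m j) (Suc m) (Suc m))] @ drop (Suc k) X))))"
      by (simp only: sum_shuffle_perms_last scale_sum_right)
    also have "\<dots> = (\<Sum>j = 1..Suc m. scale ((-1) ^ Suc j) (\<phi> (omit j (replace X (Suc k) (G [arg X j])))))"
    proof (rule sum.cong)
      fix j assume j: "j \<in> {1..Suc m}"
      then obtain i where i: "m + 1 = j + i" using le_Suc_ex[of j "m + 1"] by auto
      have "(-1) ^ m * (-1) ^ i = ((-1) ^ Suc j :: 'a)"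
      proof -
        have "even (m + i) \<longleftrightarrow> even (Suc j)" using i by presburger
        then show ?thesis by (auto simp: minus_one_power_iff)
      qed
      moreover have "sign (cyc_last m j) = (-1) ^ i"
        using cyc_last_permutes_sign[of j m] j i by auto
      moreover have "pick X (cyc_last m j) 1 m = omit j (take k X)"
        using j k1 assms unfolding k by (intro pick_cyc_last) auto
      moreover have "pick X (cyc_last m j) (Suc m) (Suc m) = [arg X j]"
        using j by (intro pick_cyc_last_Suc) auto
      moreover have "omit j (take k X) @ [G [arg X j]] @ drop (Suc k) X = omit j (replace X (Suc k) (G [arg X j]))"
        using j k1 assms unfolding k by (intro omit_replace) auto
      ultimately show "scale ((-1) ^ m) (scale (of_int (sign (cyc_last m j)))
          (\<phi> (pick X (cyc_last m j) 1 m @ [G (pick X (cyc_last m j) (Suc m) (Suc m))] @ drop (Suc k) X)))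
        = scale ((-1) ^ Suc j) (\<phi> (omit j (replace X (Suc k) (G [arg X j]))))"
        by simp
    qed simp
    finally show ?thesis
      unfolding k by (simp add: atLeastLessThanSuc_atLeastAtMost)
  qed
  have "insertion_sum scale n 1 \<phi> Q X
    = (\<Sum>k = 1..n. \<Sum>j = 1..<Suc k. scale ((-1) ^ Suc j)
        (\<phi> (omit j (replace X (Suc k) (fst (arg X (Suc k)), Q [arg X j] (snd (arg X (Suc k))))))))
    + (\<Sum>k = 1..n. \<Sum>j = 1..<Suc k. scale ((-1) ^ Suc j)
        (\<phi> (omit j (replace X (Suc k) (Q [arg X j] (fst (arg X (Suc k))), snd (arg X (Suc k)))))))"
    unfolding insertion_sum_def case_prod_beta
    apply (intro arg_cong2[of _ _ _ _ "(+)"] sum.cong refl)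
    subgoal for k
      using summand[of k "\<lambda>Y. (fst (arg X (k + 1)), Q Y (snd (arg X (k + 1))))"] by simp
    subgoal for k
      using summand[of k "\<lambda>Y. (Q Y (fst (arg X (k + 1))), snd (arg X (k + 1)))"] by simp
    done
  also have "\<dots> = (\<Sum>k = 1..n. \<Sum>j = 1..<Suc k. scale ((-1) ^ Suc j)
      (circ_sum (\<lambda>a b. Q [(a, b)]) \<phi> X j (Suc k)))"
    unfolding circ_sum_def case_prod_beta scale_right_distrib sum.distrib fst_conv snd_conv prod.collapse
    by (rule add.commute)
  \<comment> \<open>Reindexing by \<open>l = k + 1\<close>; the extra value \<open>l = 1\<close> has
    an empty inner sum.\<close>
  also have "\<dots> = (\<Sum>l = 1..Suc n. \<Sum>j = 1..<l. scale ((-1) ^ Suc j) (circ_sum (\<lambda>a b. Q [(a, b)]) \<phi> X j l))"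
    by (subst (2) sum.atLeast_Suc_atMost) (simp_all only: sum.shift_bounds_cl_Suc_ivl, simp_all)
  finally show ?thesis .
qed

text \<open>The cycle contributes \<open>(-1) ^ (k - 1)\<close> to the sign \<open>(-1) ^ n\<close>
  of the composition. Keeping \<open>\<Phi>\<close> arbitrary covers both components of a
  composition with a left factor of degree 1.\<close>

lemma shuffle_sum_first:
  assumes "length X = Suc n"
  shows "(\<Sum>\<sigma>\<in>shuffle_perms 1 n. scale ((-1) ^ (1 * n) * of_int (sign \<sigma>)) (\<Phi> (pick X \<sigma> 1 1) (pick X \<sigma> (1 + 1) (1 + n))))
    = (\<Sum>k = 1..Suc n. scale ((-1) ^ (n + k + 1)) (\<Phi> [arg X k] (omit k X)))"
    and "1 \<le> n \<Longrightarrow> (\<Sum>\<sigma>\<in>{\<sigma> \<in> shuffle_perms 1 n. \<sigma> (1 + n) = 1 + n}. scale ((-1) ^ (1 * n) * of_int (sign \<sigma>)) (\<Phi> (pick X \<sigma> 1 1) (pick X \<sigma> (1 + 1) (1 + n))))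
    = (\<Sum>k = 1..n. scale ((-1) ^ (n + k + 1)) (\<Phi> [arg X k] (omit k X)))"
proof -
  have *: "scale ((-1) ^ (1 * n) * of_int (sign (cyc_first k))) (\<Phi> (pick X (cyc_first k) 1 1) (pick X (cyc_first k) (1 + 1) (1 + n)))
    = scale ((-1) ^ (n + k + 1)) (\<Phi> [arg X k] (omit k X))" if "k \<in> {1..Suc n}" for k
  proof -
    have "(-1) ^ n * (-1) ^ (k - 1) = ((-1) ^ (n + k + 1) :: 'a)"
      using that by (cases k) (simp_all add: power_add)
    then show ?thesis
      using that pick_cyc_first[of k n X] assms cyc_first_permutes_sign[of k n]
      by (simp add: pick_cyc_first_1[unfolded One_nat_def] numeral_2_eq_2)
  qed
  show "(\<Sum>\<sigma>\<in>shuffle_perms 1 n. scale ((-1) ^ (1 * n) * of_int (sign \<sigma>)) (\<Phi> (pick X \<sigma> 1 1) (pick X \<sigma> (1 + 1) (1 + n))))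
    = (\<Sum>k = 1..Suc n. scale ((-1) ^ (n + k + 1)) (\<Phi> [arg X k] (omit k X)))"
    unfolding sum_shuffle_perms_first by (intro sum.cong refl *)
  show "(\<Sum>\<sigma>\<in>{\<sigma> \<in> shuffle_perms 1 n. \<sigma> (1 + n) = 1 + n}. scale ((-1) ^ (1 * n) * of_int (sign \<sigma>)) (\<Phi> (pick X \<sigma> 1 1) (pick X \<sigma> (1 + 1) (1 + n))))
    = (\<Sum>k = 1..n. scale ((-1) ^ (n + k + 1)) (\<Phi> [arg X k] (omit k X)))" if "1 \<le> n"
    unfolding plus_1_eq_Suc sum_shuffle_perms_first_fixed[OF that]
    by (intro sum.cong refl *[unfolded plus_1_eq_Suc]) auto
qed

text \<open>Mirror image, for a right factor of degree 1: \<open>(-1) ^ n\<close> times the sign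
  \<open>(-1) ^ (n + 1 - k)\<close> is \<open>(-1) ^ (k + 1)\<close>, and fixing the last point
  leaves only the identity.\<close>

lemma shuffle_sum_last:
  assumes "length X = Suc n"
  shows "(\<Sum>\<sigma>\<in>shuffle_perms n 1. scale ((-1) ^ (n * 1) * of_int (sign \<sigma>)) (\<Phi> (pick X \<sigma> 1 n) (pick X \<sigma> (n + 1) (n + 1))))
    = (\<Sum>k = 1..Suc n. scale ((-1) ^ (k + 1)) (\<Phi> (omit k X) [arg X k]))"
    and "(\<Sum>\<sigma>\<in>{\<sigma> \<in> shuffle_perms n 1. \<sigma> (n + 1) = n + 1}. scale ((-1) ^ (n * 1) * of_int (sign \<sigma>)) (\<Phi> (pick X \<sigma> 1 n) (pick X \<sigma> (n + 1) (n + 1))))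
    = scale ((-1) ^ n) (\<Phi> (take n X) [arg X (Suc n)])"
proof -
  have *: "scale ((-1) ^ (n * 1) * of_int (sign (cyc_last n k))) (\<Phi> (pick X (cyc_last n k) 1 n) (pick X (cyc_last n k) (n + 1) (n + 1)))
    = scale ((-1) ^ (k + 1)) (\<Phi> (omit k X) [arg X k])" if k1: "k \<in> {1..Suc n}" for k
  proof -
    obtain i where i: "n + 1 = k + i" using k1 le_Suc_ex[of k "n + 1"] by auto
    have "even (n + i) \<longleftrightarrow> even (k + 1)" using i by presburger
    then have "(-1) ^ n * (-1) ^ i = ((-1) ^ (k + 1) :: 'a)"
      by (auto simp: minus_one_power_iff)
    moreover have "sign (cyc_last n k) = (-1) ^ i"
      using k1 i cyc_last_permutes_sign[of k n] by auto
    ultimately show ?thesis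
      using k1 pick_cyc_last[of k n X] assms pick_cyc_last_Suc[of k n X] by simp
  qed
  show "(\<Sum>\<sigma>\<in>shuffle_perms n 1. scale ((-1) ^ (n * 1) * of_int (sign \<sigma>)) (\<Phi> (pick X \<sigma> 1 n) (pick X \<sigma> (n + 1) (n + 1))))
    = (\<Sum>k = 1..Suc n. scale ((-1) ^ (k + 1)) (\<Phi> (omit k X) [arg X k]))"
    unfolding sum_shuffle_perms_last by (intro sum.cong refl *)
  show "(\<Sum>\<sigma>\<in>{\<sigma> \<in> shuffle_perms n 1. \<sigma> (n + 1) = n + 1}. scale ((-1) ^ (n * 1) * of_int (sign \<sigma>)) (\<Phi> (pick X \<sigma> 1 n) (pick X \<sigma> (n + 1) (n + 1))))
    = scale ((-1) ^ n) (\<Phi> (take n X) [arg X (Suc n)])"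
    using assms
    by (simp add: sum_shuffle_perms_last_fixed[unfolded One_nat_def] pick_id[unfolded One_nat_def]
          sign_id del: upt_Suc) (simp add: pick_def)
qed

end

section \<open>Brackets with a lifted cochain\<close>

lemma omit_map: "omit k (map h X) = map h (omit k X)"
  by (simp add: omit_def take_map drop_map)

lemma arg_map: "1 \<le> k \<Longrightarrow> k \<le> length X \<Longrightarrow> arg (map h X) k = h (arg X k)"
  by (simp add: arg_def)

lemma map_prod_snd_Pair [simp]: "map_prod snd snd \<circ> map_prod (Pair a) (Pair b) = id"
  by (simp add: fun_eq_iff)

text \<open>Closed form of the first component of the projected bracket of a degree 1 cochain
  \<open>(P, Q)\<close>, written as functions of a single pair, with the lift of
  \<open>(f, g)\<close>. The terms are arranged as in \<open>coboundary_I\<close>, up to the common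
  factor \<open>(-1) ^ n\<close>.\<close>

definition pr_bracket_I ::
  "('k::field \<Rightarrow> 'g \<Rightarrow> 'g) \<Rightarrow> (('g \<times> 'v) \<times> ('g \<times> 'v) \<Rightarrow> 'g \<times> 'v) \<Rightarrow> (('g \<times> 'v) \<times> ('g \<times> 'v) \<Rightarrow> 'g \<times> 'v \<Rightarrow> 'g \<times> 'v)
    \<Rightarrow> nat \<Rightarrow> (('v \<times> 'v) list \<Rightarrow> 'g) \<Rightarrow> (('v \<times> 'v) list \<Rightarrow> 'v \<Rightarrow> 'g) \<Rightarrow> ('v::ab_group_add \<times> 'v) list \<Rightarrow> 'g::ab_group_add"
  where "pr_bracket_I s P Q n f g X =
    (case arg X (n + 1) of (u, v) \<Rightarrow>
      fst (P ((0, u), (g (take n X) v, 0))) + fst (P ((g (take n X) u, 0), (0, v)))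
        - g (take n X) (snd (P ((0, u), (0, v)))))
    + (\<Sum>k = 1..n. s ((-1) ^ (n + k + 1))
        (fst (Q (map_prod (Pair 0) (Pair 0) (arg X k)) (f (omit k X), 0))))
    + (\<Sum>l = 1..n + 1. \<Sum>k = 1..<l. s ((-1) ^ (n + k))
        (circ_sum (\<lambda>a b c. snd (Q ((0, a), (0, b)) (0, c))) f X k l))"

definition pr_bracket_II ::
  "('k::field \<Rightarrow> 'g \<Rightarrow> 'g) \<Rightarrow> (('g \<times> 'v) \<times> ('g \<times> 'v) \<Rightarrow> 'g \<times> 'v \<Rightarrow> 'g \<times> 'v)
    \<Rightarrow> nat \<Rightarrow> (('v \<times> 'v) list \<Rightarrow> 'v \<Rightarrow> 'g) \<Rightarrow> ('v::ab_group_add \<times> 'v) list \<Rightarrow> 'v \<Rightarrow> 'g::ab_group_add"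
  where "pr_bracket_II s Q n g X w =
    (case arg X (n + 1) of (u, v) \<Rightarrow>
      fst (Q ((0, u), (g (take n X) v, 0)) (0, w)) + fst (Q ((g (take n X) u, 0), (0, v)) (0, w)))
    + (\<Sum>k = 1..n + 1. s ((-1) ^ (n + k + 1))
        (fst (Q (map_prod (Pair 0) (Pair 0) (arg X k)) (g (omit k X) w, 0))))
    + (\<Sum>l = 1..n + 1. \<Sum>k = 1..<l. s ((-1) ^ (n + k))
        (circ_sum (\<lambda>a b c. snd (Q ((0, a), (0, b)) (0, c))) (\<lambda>Y. g Y w) X k l))
    + (\<Sum>k = 1..n + 1. s ((-1) ^ (n + k))
        (g (omit k X) (snd (Q (map_prod (Pair 0) (Pair 0) (arg X k)) (0, w)))))"

context vector_space_prod
begin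

lemma fst_scale: "fst (scale c x) = s1 c (fst x)"
  by (simp add: scale_def)

lemma circ_sum_lift:
  assumes "1 \<le> k" "k < l" "l \<le> length X"
  shows "fst (circ_sum t (\<lambda>Z. (\<phi> (map (map_prod snd snd) Z), 0)) (map (map_prod (Pair 0) (Pair 0)) X) k l)
    = circ_sum (\<lambda>a b c. snd (t (0, a) (0, b) (0, c))) \<phi> X k l"
  using assms
  by (simp add: circ_sum_def case_prod_beta arg_map flip: omit_map)
     (simp add: replace_def map_update comp_def prod.map_comp)

text \<open>The outer scalar is the sign of the second composition in a bracket of degrees 1 and
  \<open>n\<close>; the inner one arises inside that composition.\<close>

lemma neg_minus_one_power: "s1 (- ((-1) ^ n)) (s1 ((-1) ^ Suc k) x) = s1 ((-1) ^ (n + k)) x"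
  by (simp add: power_add)

text \<open>In each component, facts 1 and 2 evaluate the composition with the lift on the right,
  facts 3 and 4 the one with the lift on the left. A lifted cochain reads only the V-parts of its
  arguments and has values in the first summand, which explains each \<open>fst\<close> and
  \<open>snd\<close>.\<close>

lemma pr_bracket_lift:
  assumes "1 \<le> n"
  shows "pr_cochain (LieY_bracket scale (Cochain 1 P Q) (lift_cochain (Cochain n f g)))
    = mk_cochain (Suc n) (pr_bracket_I s1 (\<lambda>a. P [a]) (\<lambda>a. Q [a]) n f g) (pr_bracket_II s1 (\<lambda>a. Q [a]) n g)"
proof -
  let ?e = "map (map_prod (Pair 0) (Pair 0)) :: ('c \<times> 'c) list \<Rightarrow> (('b \<times> 'c) \<times> ('b \<times> 'c)) list"
  let ?\<pi> = "map (map_prod snd snd) :: (('b \<times> 'c) \<times> ('b \<times> 'c)) list \<Rightarrow> ('c \<times> 'c) list"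
  let ?f = "\<lambda>Z. (f (?\<pi> Z), 0 :: 'c)" and ?g = "\<lambda>Z e. (g (?\<pi> Z) (snd e), 0 :: 'c)"
  have neg: "s1 (- ((-1) ^ n)) (s1 ((-1) ^ n) x) = - x" for x
    by (simp flip: power_mult_distrib)
  have I: "fst ((\<Sum>\<sigma>\<in>{\<sigma> \<in> shuffle_perms 1 n. \<sigma> (1 + n) = 1 + n}. scale ((-1) ^ (1 * n) * of_int (sign \<sigma>))
            (Q (pick (?e X) \<sigma> 1 1) (?f (pick (?e X) \<sigma> (1 + 1) (1 + n)))))
         + insertion_sum scale 1 n P ?g (?e X))
      + s1 (- ((-1) ^ n)) (fst ((\<Sum>\<sigma>\<in>{\<sigma> \<in> shuffle_perms n 1. \<sigma> (n + 1) = n + 1}. scale ((-1) ^ (n * 1) * of_int (sign \<sigma>))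
            (?g (pick (?e X) \<sigma> 1 n) (P (pick (?e X) \<sigma> (n + 1) (n + 1)))))
         + insertion_sum scale n 1 ?f Q (?e X)))
      = pr_bracket_I s1 (\<lambda>a. P [a]) (\<lambda>a. Q [a]) n f g X" if X: "length X = Suc n" for X
  proof -
    have eX: "length (?e X) = Suc n" using X by simp
    have 1: "fst (\<Sum>\<sigma>\<in>{\<sigma> \<in> shuffle_perms 1 n. \<sigma> (1 + n) = 1 + n}. scale ((-1) ^ (1 * n) * of_int (sign \<sigma>))
            (Q (pick (?e X) \<sigma> 1 1) (?f (pick (?e X) \<sigma> (1 + 1) (1 + n)))))
        = (\<Sum>k = 1..n. s1 ((-1) ^ (n + k + 1)) (fst (Q [map_prod (Pair 0) (Pair 0) (arg X k)] (f (omit k X), 0))))"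
      unfolding p.shuffle_sum_first(2)[OF eX assms, of "\<lambda>Y Z. Q Y (?f Z)"] fst_sum
      using X by (intro sum.cong) (simp_all add: fst_scale omit_map arg_map del: power_Suc)
    have 2: "fst (insertion_sum scale 1 n P ?g (?e X)) = (case arg X (n + 1) of (u, v) \<Rightarrow>
        fst (P [((0, u), (g (take n X) v, 0))]) + fst (P [((g (take n X) u, 0), (0, v))]))"
      unfolding p.insertion_sum_single_left[OF eX]
      using X by (simp add: arg_map take_map split: prod.split)
    have 3: "s1 (- ((-1) ^ n)) (fst (\<Sum>\<sigma>\<in>{\<sigma> \<in> shuffle_perms n 1. \<sigma> (n + 1) = n + 1}. scale ((-1) ^ (n * 1) * of_int (sign \<sigma>))
            (?g (pick (?e X) \<sigma> 1 n) (P (pick (?e X) \<sigma> (n + 1) (n + 1))))))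
        = - g (take n X) (snd (P [map_prod (Pair 0) (Pair 0) (arg X (n + 1))]))"
      unfolding p.shuffle_sum_last(2)[OF eX, of "\<lambda>Y Z. ?g Y (P Z)"] fst_scale neg
      using X by (simp add: arg_map take_map)
    have 4: "s1 (- ((-1) ^ n)) (fst (insertion_sum scale n 1 ?f Q (?e X)))
        = (\<Sum>l = 1..n + 1. \<Sum>k = 1..<l. s1 ((-1) ^ (n + k))
        (circ_sum (\<lambda>a b c. snd (Q [((0, a), (0, b))] (0, c))) f X k l))"
      unfolding p.insertion_sum_single_right[OF eX] fst_sum fst_scale vs1.scale_sum_right neg_minus_one_power
      using X by (intro sum.cong) (simp_all add: circ_sum_lift)
    show ?thesis
      unfolding fst_add vs1.scale_right_distrib 1 2 3 4 pr_bracket_I_def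
      by (simp add: case_prod_beta map_prod_def)
  qed
  have II: "fst ((\<Sum>\<sigma>\<in>shuffle_perms 1 n. scale ((-1) ^ (1 * n) * of_int (sign \<sigma>))
            (Q (pick (?e X) \<sigma> 1 1) (?g (pick (?e X) \<sigma> (1 + 1) (1 + n)) (0, w))))
         + insertion_sum scale 1 n (\<lambda>Y. Q Y (0, w)) ?g (?e X))
      + s1 (- ((-1) ^ n)) (fst ((\<Sum>\<sigma>\<in>shuffle_perms n 1. scale ((-1) ^ (n * 1) * of_int (sign \<sigma>))
            (?g (pick (?e X) \<sigma> 1 n) (Q (pick (?e X) \<sigma> (n + 1) (n + 1)) (0, w))))
         + insertion_sum scale n 1 (\<lambda>Y. ?g Y (0, w)) Q (?e X)))
      = pr_bracket_II s1 (\<lambda>a. Q [a]) n g X w" if X: "length X = Suc n" for X w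
  proof -
    have eX: "length (?e X) = Suc n" using X by simp
    have 1: "fst (\<Sum>\<sigma>\<in>shuffle_perms 1 n. scale ((-1) ^ (1 * n) * of_int (sign \<sigma>))
            (Q (pick (?e X) \<sigma> 1 1) (?g (pick (?e X) \<sigma> (1 + 1) (1 + n)) (0, w))))
        = (\<Sum>k = 1..n + 1. s1 ((-1) ^ (n + k + 1)) (fst (Q [map_prod (Pair 0) (Pair 0) (arg X k)] (g (omit k X) w, 0))))"
      unfolding p.shuffle_sum_first(1)[OF eX, of "\<lambda>Y Z. Q Y (?g Z (0, w))"] fst_sum
      using X by (intro sum.cong) (simp_all add: fst_scale omit_map arg_map del: power_Suc)
    have 2: "fst (insertion_sum scale 1 n (\<lambda>Y. Q Y (0, w)) ?g (?e X)) = (case arg X (n + 1) of (u, v) \<Rightarrow>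
        fst (Q [((0, u), (g (take n X) v, 0))] (0, w)) + fst (Q [((g (take n X) u, 0), (0, v))] (0, w)))"
      unfolding p.insertion_sum_single_left[OF eX]
      using X by (simp add: arg_map take_map split: prod.split)
    have 3: "s1 (- ((-1) ^ n)) (fst (\<Sum>\<sigma>\<in>shuffle_perms n 1. scale ((-1) ^ (n * 1) * of_int (sign \<sigma>))
            (?g (pick (?e X) \<sigma> 1 n) (Q (pick (?e X) \<sigma> (n + 1) (n + 1)) (0, w)))))
        = (\<Sum>k = 1..n + 1. s1 ((-1) ^ (n + k)) (g (omit k X) (snd (Q [map_prod (Pair 0) (Pair 0) (arg X k)] (0, w)))))"
      unfolding p.shuffle_sum_last(1)[OF eX, of "\<lambda>Y Z. ?g Y (Q Z (0, w))"]
      unfolding fst_sum fst_scale vs1.scale_sum_right Suc_eq_plus1[symmetric] neg_minus_one_power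
      using X by (intro sum.cong) (simp_all add: arg_map omit_map)
    have 4: "s1 (- ((-1) ^ n)) (fst (insertion_sum scale n 1 (\<lambda>Y. ?g Y (0, w)) Q (?e X)))
        = (\<Sum>l = 1..n + 1. \<Sum>k = 1..<l. s1 ((-1) ^ (n + k))
        (circ_sum (\<lambda>a b c. snd (Q [((0, a), (0, b))] (0, c))) (\<lambda>Y. g Y w) X k l))"
      unfolding p.insertion_sum_single_right[OF eX] fst_sum fst_scale vs1.scale_sum_right neg_minus_one_power
      using X by (intro sum.cong) (simp_all add: circ_sum_lift[where \<phi> = "\<lambda>Y. g Y w"])
    show ?thesis
      unfolding fst_add vs1.scale_right_distrib 1 2 3 4 pr_bracket_II_def
      by (simp add: add_ac)
  qed
  show ?thesis
    unfolding LieY_bracket_def lift_cochain.simps cochain_comp.simps mk_cochain_def cochain_scale.simps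
      cochain_add.simps pr_cochain.simps cochain_degree.simps fst_add fst_scale cochain.inject
  \<comment> \<open>The computations above concern lists of length \<open>Suc n\<close>; on all
    other lists both sides are the default \<open>0\<close>.\<close>
  proof (intro conjI ext, goal_cases)
    case (2 X)
    show ?case using I[of X] by (cases "length X = Suc n") (simp_all only: mult_1 fst_add fst_scale length_map, simp_all)
  next
    case (3 X w)
    show ?case using II[of X w] by (cases "length X = Suc n") (simp_all only: mult_1 fst_add fst_scale length_map, simp_all)
  qed simp
qed

end

section \<open>Iterated brackets of the structure cochain with the operator\<close>

text \<open>First component of the bracket of a degree 1 cochain with \<open>Hom h\<close>, as a
  function of one pair; \<open>ad_II\<close> is the second.\<close>

definition ad_I :: "('e \<Rightarrow> 'e) \<Rightarrow> ('e \<times> 'e \<Rightarrow> 'e) \<Rightarrow> 'e \<times> 'e \<Rightarrow> 'e::ab_group_add"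
  where "ad_I h P = (\<lambda>(x, y). P (x, h y) + P (h x, y) - h (P (x, y)))"

definition ad_II :: "('e \<Rightarrow> 'e) \<Rightarrow> ('e \<times> 'e \<Rightarrow> 'e \<Rightarrow> 'e) \<Rightarrow> 'e \<times> 'e \<Rightarrow> 'e \<Rightarrow> 'e::ab_group_add"
  where "ad_II h Q = (\<lambda>(x, y) e. Q (x, h y) e + Q (h x, y) e + Q (x, y) (h e) - h (Q (x, y) e))"

lemma (in vector_space) LieY_bracket_Hom:
  "LieY_bracket scale (mk_cochain 1 (\<lambda>X. P (arg X 1)) (\<lambda>X. Q (arg X 1))) (Hom h)
    = mk_cochain 1 (\<lambda>X. ad_I h P (arg X 1)) (\<lambda>X. ad_II h Q (arg X 1))"
  by (auto simp: LieY_bracket_def mk_cochain_def derivation_sum_def ad_I_def ad_II_def fun_eq_iff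
      replace_def arg_def split: prod.split)

text \<open>Entry \<open>l\<close> has list index \<open>l - 1\<close>, and omitting the earlier
  entry \<open>k\<close> shifts it to \<open>l - 2\<close>.\<close>

lemma omit_replace_list_update:
  assumes "1 \<le> k" "k < l" "l \<le> length X"
  shows "omit k (replace X l a) = (omit k X)[l - 2 := a]"
  using assms
  by (simp add: omit_def replace_def list_update_append drop_update_swap numeral_2_eq_2)

text \<open>Each summand of \<open>circ_sum\<close> contains one value of the ternary map, in a slot
  where \<open>\<phi>\<close> is linear.\<close>

lemma circ_sum_scale:
  assumes "wedge_multilinear sA sB n \<phi>" "length X = Suc n" "1 \<le> k" "k < l" "l \<le> Suc n"
  shows "circ_sum (\<lambda>a b x. sA c (t a b x)) \<phi> X k l = sB c (circ_sum t \<phi> X k l)"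
proof -
  have len: "length (omit k X) = n"
    using assms by (simp add: omit_def)
  have *: "Vector_Spaces.linear sA sB (\<lambda>x. \<phi> ((omit k X)[l - 2 := (x, y)]))"
    "Vector_Spaces.linear sA sB (\<lambda>x. \<phi> ((omit k X)[l - 2 := (y, x)]))" for y
    using assms len unfolding wedge_multilinear_def by auto
  \<comment> \<open>The vector space laws of \<open>sB\<close> are recovered from linearity of
    \<open>\<phi>\<close> in one slot.\<close>
  interpret B: vector_space sB
    using *(1) by (simp add: Vector_Spaces.linear_iff)
  show ?thesis
    using assms *[THEN Vector_Spaces.linear.axioms(3), THEN module_hom.scale] unfolding circ_sum_def case_prod_beta
    by (simp add: omit_replace_list_update B.scale_right_distrib)
qed

context relative_rota_baxter
begin

sublocale E: vector_space_prod sG sV ..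

lemmas linear_simps =
  br_linear_1 br_linear_2 tr_linear_1 tr_linear_2 tr_linear_3
  rho_linear_1 rho_linear_2 mu_linear_1 mu_linear_2 mu_linear_3 T_linear

lemmas zero_simps [simp] = linear_simps[THEN Vector_Spaces.linear.axioms(3), THEN module_hom.zero]
lemmas add_simps = linear_simps[THEN Vector_Spaces.linear.axioms(3), THEN module_hom.add]
lemmas diff_simps = linear_simps[THEN Vector_Spaces.linear.axioms(3), THEN module_hom.diff]
lemmas neg_simps = linear_simps[THEN Vector_Spaces.linear.axioms(3), THEN module_hom.neg]

section \<open>Antisymmetry and the operator D of the induced representation\<close>

lemma br_anti: "br x y = - br y x"
proof -
  have "br x y + br y x = br (x + y) (x + y)"
    by (simp only: add_simps) (simp add: br_alt add.commute)
  then show ?thesis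
    by (simp only: br_alt eq_neg_iff_add_eq_0)
qed

lemma tr_anti: "tr x y z = - tr y x z"
proof -
  have "tr x y z + tr y x z = tr (x + y) (x + y) z"
    by (simp only: add_simps) (simp add: tr_alt add.commute)
  then show ?thesis
    by (simp only: tr_alt eq_neg_iff_add_eq_0)
qed

lemma rep_D_anti: "rep_D br \<rho> \<mu> x y u = - rep_D br \<rho> \<mu> y x u"
  using br_anti[of x y] by (simp add: rep_D_def neg_simps)

lemma rep_D_0 [simp]: "rep_D br \<rho> \<mu> 0 y u = 0" "rep_D br \<rho> \<mu> x 0 u = 0" "rep_D br \<rho> \<mu> x y 0 = 0"
  by (simp_all add: rep_D_def)

text \<open>\<open>LY1\<close> at \<open>T u\<close>, \<open>T v\<close>, \<open>x\<close> expresses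
  the ternary bracket by iterated binary brackets and the ternary terms of \<open>varpi\<close>. By
  the Rota-Baxter identity the terms inside \<open>T\<close> then cancel except for the two with
  \<open>\<mu>\<close>.\<close>

lemma rep_D_sub:
  "rep_D (sub_br \<rho> T) (varrho br \<rho> T) (varpi br tr \<rho> \<mu> T) u v x
    = tr (T u) (T v) x - T (\<mu> (T v) x u - \<mu> (T u) x v)"
proof -
  have anti: "br (br (T v) x) (T u) = - br (T u) (br (T v) x)"
    "br (br x (T u)) (T v) = br (T v) (br (T u) x)" "tr (T v) x (T u) = - tr x (T v) (T u)"
    using br_anti tr_anti by (metis minus_minus neg_simps(2))+
  have "tr (T u) (T v) x = - (br (br (T u) (T v)) x + br (br (T v) x) (T u) + br (br x (T u)) (T v))
      - tr (T v) x (T u) - tr x (T u) (T v)"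
    using LY1[of "T u" "T v" x] by (simp only: eq_diff_eq eq_neg_iff_add_eq_0 ac_simps)
  then have ly: "tr (T u) (T v) x = br (T u) (br (T v) x) - br (T v) (br (T u) x) - br (br (T u) (T v)) x
      + tr x (T v) (T u) - tr x (T u) (T v)"
    unfolding anti by simp
  have rb: "br (T u) (T w) = T (\<rho> (T u) w) - T (\<rho> (T w) u)" for u w
    unfolding RB_br by (simp add: sub_br_def diff_simps)
  show ?thesis
    unfolding ly
    by (simp add: rep_D_def sub_br_def varrho_def varpi_def add_simps diff_simps neg_simps rb
        br_anti[of x "T u"] br_anti[of x "T v"])
qed

section \<open>Components of the iterated brackets with \<open>T\<close>\<close>

abbreviation T_E where "T_E \<equiv> \<lambda>e. (T (snd e), 0 :: 'v)"

definition Delta_I where "Delta_I = (\<lambda>((x, u), (y, v)). (br x y, \<rho> x v - \<rho> y u))"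

definition Delta_II where "Delta_II = (\<lambda>((x, u), (y, v)) (z, w).
  (tr x y z, rep_D br \<rho> \<mu> x y w + \<mu> y z u - \<mu> x z v))"

lemma Delta_eq: "Delta br tr \<rho> \<mu> = mk_cochain 1 (\<lambda>X. Delta_I (arg X 1)) (\<lambda>X. Delta_II (arg X 1))"
  by (simp add: Delta_def Delta_I_def Delta_II_def mk_cochain_def fun_eq_iff case_prod_beta)

definition Delta_T_I where "Delta_T_I = ad_I T_E Delta_I"
definition Delta_T_II where "Delta_T_II = ad_II T_E Delta_II"
definition Delta_TT_I where "Delta_TT_I = ad_I T_E Delta_T_I"
definition Delta_TT_II where "Delta_TT_II = ad_II T_E Delta_T_II"

lemma l1_twisted_eq: "l1_twisted sG sV br tr \<rho> \<mu> T F = cochain_add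
    (pr_cochain (LieY_bracket E.scale (mk_cochain 1 (\<lambda>X. Delta_T_I (arg X 1)) (\<lambda>X. Delta_T_II (arg X 1))) (lift_cochain F)))
    (cochain_scale sG (1 / 2) (pr_cochain (LieY_bracket E.scale
      (mk_cochain 1 (\<lambda>X. Delta_TT_I (arg X 1)) (\<lambda>X. Delta_TT_II (arg X 1))) (lift_cochain F))))"
  by (simp only: l1_twisted_def l2_def l3_def Let_def lift_cochain.simps Delta_eq E.p.LieY_bracket_Hom
      Delta_T_I_def Delta_T_II_def Delta_TT_I_def Delta_TT_II_def)

text \<open>Give V degree 1 and the other summand degree 0. Then \<open>Delta\<close> preserves the
  total degree and \<open>T_E\<close> lowers it by 1, so a value of \<open>Delta_T_I\<close> or
  \<open>Delta_T_II\<close> has one degree less than its arguments; this forces the zeros.\<close>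

lemma Delta_T_values:
  "Delta_T_I ((0, u), (x, 0)) = (varrho br \<rho> T u x, 0)"
  "Delta_T_I ((x, 0), (0, v)) = (- varrho br \<rho> T v x, 0)"
  "Delta_T_I ((0, u), (0, v)) = (0, sub_br \<rho> T u v)"
  "fst (Delta_T_II ((0, u), (0, v)) (x, 0)) = 0"
  "fst (Delta_T_II ((0, u), (x, 0)) (0, w)) = 0"
  "fst (Delta_T_II ((x, 0), (0, v)) (0, w)) = 0"
  "snd (Delta_T_II ((0, u), (0, v)) (0, w)) = 0"
  using br_anti[of x "T v"]
  by (simp_all add: Delta_T_I_def Delta_T_II_def ad_I_def ad_II_def Delta_I_def Delta_II_def
      varrho_def sub_br_def neg_simps)

text \<open>Now the degree drops by 2. The factor 2 counts the two orders in which the copies of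
  \<open>T\<close> enter and will cancel the \<open>1 / 2\<close> of \<open>l1_twisted\<close>.
  Antisymmetry in the first two arguments gives the sign of \<open>varpi\<close>.\<close>

lemma Delta_TT_values:
  "fst (Delta_TT_I ((0, u), (x, 0))) = 0"
  "fst (Delta_TT_I ((x, 0), (0, v))) = 0"
  "snd (Delta_TT_I ((0, u), (0, v))) = 0"
  "fst (Delta_TT_II ((0, u), (0, v)) (x, 0))
    = sG 2 (rep_D (sub_br \<rho> T) (varrho br \<rho> T) (varpi br tr \<rho> \<mu> T) u v x)"
  "fst (Delta_TT_II ((0, u), (x, 0)) (0, w)) = sG 2 (- varpi br tr \<rho> \<mu> T u w x)"
  "fst (Delta_TT_II ((x, 0), (0, v)) (0, w)) = sG 2 (varpi br tr \<rho> \<mu> T v w x)"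
  "snd (Delta_TT_II ((0, u), (0, v)) (0, w)) = sV 2 (sub_tr br \<rho> \<mu> T u v w)"
  \<comment> \<open>The two instances at \<open>1 1\<close> turn scaling by 2 into a sum of two
    equal terms.\<close>
  using tr_anti[of "T u" x] rep_D_anti[of "T u" x] scale_left_distrib[of 1 1] V.scale_left_distrib[of 1 1]
  by (simp_all add: Delta_TT_I_def Delta_TT_II_def Delta_T_I_def Delta_T_II_def ad_I_def ad_II_def Delta_I_def Delta_II_def
      varpi_def sub_tr_def rep_D_sub neg_simps add_simps diff_simps)

end

section \<open>Comparison with the coboundary\<close>

context relative_rota_baxter
begin

text \<open>In degree 0 the last bracket is again of the form \<open>ad_I\<close>,
  \<open>ad_II\<close>, so neither shuffles nor a sign appear.\<close>

lemma rb_coboundary_Hom: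
  assumes f: "Vector_Spaces.linear sV sG f"
  shows "rb_coboundary sG br tr \<rho> \<mu> T (Hom f) = l1_twisted sG sV br tr \<rho> \<mu> T (Hom f)"
proof -
  note f_hom = f[THEN Vector_Spaces.linear.axioms(3)]
  have f0 [simp]: "f 0 = 0" and f_scale: "f (sV c w) = sG c (f w)" for c w
    using module_hom.zero[OF f_hom] module_hom.scale[OF f_hom] by auto
  have bracket: "pr_cochain (LieY_bracket E.scale (mk_cochain 1 (\<lambda>X. P (arg X 1)) (\<lambda>X. Q (arg X 1))) (lift_cochain (Hom f)))
    = mk_cochain 1
      (\<lambda>X. case arg X 1 of (u, v) \<Rightarrow> fst (P ((0, u), (f v, 0))) + fst (P ((f u, 0), (0, v)))
        - f (snd (P ((0, u), (0, v)))))
      (\<lambda>X w. case arg X 1 of (u, v) \<Rightarrow> fst (Q ((0, u), (f v, 0)) (0, w)) + fst (Q ((f u, 0), (0, v)) (0, w))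
        + fst (Q ((0, u), (0, v)) (f w, 0)) - f (snd (Q ((0, u), (0, v)) (0, w))))" for P Q
    unfolding lift_cochain.simps E.p.LieY_bracket_Hom
    by (auto simp: mk_cochain_def ad_I_def ad_II_def arg_map fun_eq_iff split: prod.split)
  show ?thesis
    unfolding l1_twisted_eq bracket
    by (auto simp: rb_coboundary_def mk_cochain_def Delta_T_values Delta_TT_values f_scale scale_right_diff_distrib
        scale_right_distrib fun_eq_iff simp del: scale_minus_right split: prod.split)
qed

lemma circ_sum_zero:
  assumes "wedge_multilinear sV sG n \<phi>" "length X = Suc n" "1 \<le> k" "k < l" "l \<le> Suc n"
  shows "circ_sum (\<lambda>a b x. 0) \<phi> X k l = 0"
  using circ_sum_scale[OF assms, of 0 "\<lambda>a b x. 0"] by simp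

text \<open>\<open>Delta_T_I\<close> supplies the binary terms of the first component; all other
  terms come from \<open>Delta_TT_II\<close>.\<close>

lemma pr_bracket_eq_coboundary:
  assumes X: "length X = Suc n" and f: "wedge_multilinear sV sG n f"
    and g: "\<And>w. wedge_multilinear sV sG n (\<lambda>Y. g Y w)"
    and g_lin: "\<And>Y. length Y = n \<Longrightarrow> Vector_Spaces.linear sV sG (g Y)"
  shows "sG ((-1) ^ n) (pr_bracket_I sG Delta_T_I Delta_T_II n f g X + sG (1 / 2) (pr_bracket_I sG Delta_TT_I Delta_TT_II n f g X))
    = coboundary_I sG (sub_br \<rho> T) (sub_tr br \<rho> \<mu> T) (varrho br \<rho> T) (varpi br tr \<rho> \<mu> T) n f g X" (is ?I)
    and "sG ((-1) ^ n) (pr_bracket_II sG Delta_T_II n g X w + sG (1 / 2) (pr_bracket_II sG Delta_TT_II n g X w))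
    = coboundary_II sG (sub_br \<rho> T) (sub_tr br \<rho> \<mu> T) (varrho br \<rho> T) (varpi br tr \<rho> \<mu> T) n g X w" (is ?II)
proof -
  let ?D = "rep_D (sub_br \<rho> T) (varrho br \<rho> T) (varpi br tr \<rho> \<mu> T)"
  let ?emb = "map_prod (Pair 0) (Pair 0) :: 'v \<times> 'v \<Rightarrow> ('g \<times> 'v) \<times> ('g \<times> 'v)"
  obtain u v where uv: "arg X (n + 1) = (u, v)" by fastforce
  have emb: "?emb (arg X k) = ((0, fst (arg X k)), (0, snd (arg X k)))" for k
    by (simp add: map_prod_def case_prod_beta)
  have sg: "sG ((-1) ^ n) (sG ((-1) ^ (n + k)) x) = sG ((-1) ^ k) x" for k x
    by (simp add: power_add flip: mult.assoc power_mult_distrib)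
  have two: "sG (1 / 2) (sG c (sG 2 x)) = sG c x" for c x
    by simp
  have len: "length (take n X) = n" "1 \<le> k \<Longrightarrow> k \<le> Suc n \<Longrightarrow> length (omit k X) = n" for k
    using X by (auto simp: omit_def)
  have g_scale: "g Y (sV c w) = sG c (g Y w)" and g0 [simp]: "g Y 0 = 0" if "length Y = n" for Y c w
    using g_lin[OF that, THEN Vector_Spaces.linear.axioms(3)] by (auto simp: module_hom.scale module_hom.zero)
  have A_I_eq: "pr_bracket_I sG Delta_T_I Delta_T_II n f g X
      = varrho br \<rho> T u (g (take n X) v) - varrho br \<rho> T v (g (take n X) u) - g (take n X) (sub_br \<rho> T u v)"
    using uv by (simp add: pr_bracket_I_def emb Delta_T_values circ_sum_zero[OF f X])
  have A_II_eq: "pr_bracket_II sG Delta_T_II n g X w = 0"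
    by (simp add: pr_bracket_II_def uv emb Delta_T_values circ_sum_zero[OF g X] len)
  \<comment> \<open>The exponent is grouped as \<open>n + (k + 1)\<close> so that \<open>sg\<close>
    applies with \<open>k + 1\<close> for \<open>k\<close>.\<close>
  have B_I_eq: "sG (1 / 2) (pr_bracket_I sG Delta_TT_I Delta_TT_II n f g X)
      = (\<Sum>k = 1..n. sG ((-1) ^ (n + (k + 1))) (?D (fst (arg X k)) (snd (arg X k)) (f (omit k X))))
      + (\<Sum>l = 1..n + 1. \<Sum>k = 1..<l. sG ((-1) ^ (n + k)) (circ_sum (sub_tr br \<rho> \<mu> T) f X k l))"
  proof -
    \<comment> \<open>Multilinearity of \<open>f\<close> moves the factor 2 outside, where
      \<open>two\<close> cancels it.\<close>
    have "(\<Sum>l = 1..n + 1. \<Sum>k = 1..<l. sG ((-1) ^ (n + k)) (circ_sum (\<lambda>a b c. snd (Delta_TT_II ((0, a), (0, b)) (0, c))) f X k l))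
        = (\<Sum>l = 1..n + 1. \<Sum>k = 1..<l. sG ((-1) ^ (n + k)) (sG 2 (circ_sum (sub_tr br \<rho> \<mu> T) f X k l)))"
      by (intro sum.cong) (simp_all add: Delta_TT_values circ_sum_scale[OF f X])
    then show ?thesis
      unfolding pr_bracket_I_def uv emb Delta_TT_values
      by (simp only: scale_right_distrib scale_sum_right two g0[OF len(1)] prod.case add_0_left diff_0_right add.assoc)
  qed
  have B_II_eq: "sG (1 / 2) (pr_bracket_II sG Delta_TT_II n g X w)
      = varpi br tr \<rho> \<mu> T v w (g (take n X) u) - varpi br tr \<rho> \<mu> T u w (g (take n X) v)
      + (\<Sum>k = 1..n + 1. sG ((-1) ^ (n + (k + 1))) (?D (fst (arg X k)) (snd (arg X k)) (g (omit k X) w)))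
      + (\<Sum>l = 1..n + 1. \<Sum>k = 1..<l. sG ((-1) ^ (n + k)) (circ_sum (sub_tr br \<rho> \<mu> T) (\<lambda>Y. g Y w) X k l))
      + (\<Sum>k = 1..n + 1. sG ((-1) ^ (n + k)) (g (omit k X) (sub_tr br \<rho> \<mu> T (fst (arg X k)) (snd (arg X k)) w)))"
  proof -
    have 1: "(\<Sum>l = 1..n + 1. \<Sum>k = 1..<l. sG ((-1) ^ (n + k)) (circ_sum (\<lambda>a b c. snd (Delta_TT_II ((0, a), (0, b)) (0, c))) (\<lambda>Y. g Y w) X k l))
        = (\<Sum>l = 1..n + 1. \<Sum>k = 1..<l. sG ((-1) ^ (n + k)) (sG 2 (circ_sum (sub_tr br \<rho> \<mu> T) (\<lambda>Y. g Y w) X k l)))"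
      by (intro sum.cong) (simp_all add: Delta_TT_values circ_sum_scale[OF g X])
    \<comment> \<open>Here the factor 2 sits in the last argument, where \<open>g\<close> is linear
      by \<open>g_lin\<close>.\<close>
    have 2: "(\<Sum>k = 1..n + 1. sG ((-1) ^ (n + k)) (g (omit k X) (sV 2 (sub_tr br \<rho> \<mu> T (fst (arg X k)) (snd (arg X k)) w))))
        = (\<Sum>k = 1..n + 1. sG ((-1) ^ (n + k)) (sG 2 (g (omit k X) (sub_tr br \<rho> \<mu> T (fst (arg X k)) (snd (arg X k)) w))))"
      by (intro sum.cong) (simp_all add: g_scale len)
    have 3: "sG (1 / 2) (sG 2 x) = x" for x by simp
    show ?thesis
      unfolding pr_bracket_II_def 1 uv emb unfolding Delta_TT_values 2
      by (simp only: scale_right_distrib scale_sum_right two 3 prod.case add.assoc) (simp add: 3)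
  qed
  show ?I
    unfolding A_I_eq B_I_eq coboundary_I_def uv
    by (simp only: scale_right_distrib scale_sum_right sg prod.case add.assoc)
  show ?II
    unfolding A_II_eq B_II_eq coboundary_II_def uv
    by (simp only: scale_right_distrib scale_sum_right sg prod.case add.assoc add_0_left)
qed

lemma rb_coboundary_Cochain:
  assumes n: "1 \<le> n" and F: "F \<in> cochains sV sG n"
  shows "rb_coboundary sG br tr \<rho> \<mu> T F = cochain_scale sG ((-1) ^ n) (l1_twisted sG sV br tr \<rho> \<mu> T F)"
proof -
  obtain f g where F_eq: "F = Cochain n f g" and f: "wedge_multilinear sV sG n f"
    and g: "\<And>w. wedge_multilinear sV sG n (\<lambda>Y. g Y w)"
    and g_lin: "\<And>Y. length Y = n \<Longrightarrow> Vector_Spaces.linear sV sG (g Y)"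
    using n F by (auto simp: cochains_def)
  have br: "pr_cochain (LieY_bracket E.scale (mk_cochain 1 (\<lambda>X. P (arg X 1)) (\<lambda>X. Q (arg X 1))) (lift_cochain F))
      = mk_cochain (Suc n) (pr_bracket_I sG P Q n f g) (pr_bracket_II sG Q n g)" for P Q
    \<comment> \<open>\<open>pr_bracket_lift\<close> evaluates at singleton lists, where the length
      guard holds and \<open>arg\<close> returns the element.\<close>
    unfolding F_eq mk_cochain_def[of 1] E.pr_bracket_lift[OF n] by (simp add: arg_def)
  show ?thesis
    unfolding l1_twisted_eq br
    unfolding rb_coboundary_def F_eq coboundary.simps mk_cochain_def cochain_scale.simps cochain_add.simps cochain.inject
    using pr_bracket_eq_coboundary[OF _ f g g_lin] by (auto simp: fun_eq_iff)
qed

end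

theorem theorem4p16:
  fixes sG :: "'k::field_char_0 \<Rightarrow> 'g::ab_group_add \<Rightarrow> 'g"
    and br :: "'g \<Rightarrow> 'g \<Rightarrow> 'g" and tr :: "'g \<Rightarrow> 'g \<Rightarrow> 'g \<Rightarrow> 'g"
    and sV :: "'k \<Rightarrow> 'v::ab_group_add \<Rightarrow> 'v"
    and \<rho> :: "'g \<Rightarrow> 'v \<Rightarrow> 'v" and \<mu> :: "'g \<Rightarrow> 'g \<Rightarrow> 'v \<Rightarrow> 'v"
    and T :: "'v \<Rightarrow> 'g"
  assumes "relative_rota_baxter sG br tr sV \<rho> \<mu> T"
  shows "(\<forall>n\<ge>1. \<forall>F\<in>cochains sV sG n.
            rb_coboundary sG br tr \<rho> \<mu> T F
              = cochain_scale sG ((-1) ^ n) (l1_twisted sG sV br tr \<rho> \<mu> T F))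
       \<and> (\<forall>f\<in>cochains sV sG 0.
            rb_coboundary sG br tr \<rho> \<mu> T f = l1_twisted sG sV br tr \<rho> \<mu> T f)"
proof -
  interpret relative_rota_baxter sG br tr sV \<rho> \<mu> T by (rule assms)
  show ?thesis
    by (auto simp: rb_coboundary_Cochain cochains_def[of _ _ 0] rb_coboundary_Hom)
qed

end
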